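(* Let the expressions $S^{I;\mu}$ be of canonical dimension $\omega(S^{I;\mu}) \geq 4$, at least tri-linear in the fields (and their derivatives), and satisfy, on the mass shell, $d_{\mu}S^{I;\mu} = 0$. Then $$S^{I;\mu} = d_{\nu}S^{I;\mu\nu}$$ for some expressions $S^{I;\mu\nu}$ antisymmetric in $\mu,\nu$.
   Context: Space-time is four-dimensional Minkowski space with metric $\eta_{\mu\nu}$. The $y^{\alpha}$ are finitely many classical fields (field components), each of definite Grassmann parity and of canonical dimension $1$; $d_\mu$ are the formal (total) derivatives and $y^\alpha_{\mu_1\dots\mu_k}=d_{\mu_1}\cdots d_{\mu_k}y^\alpha$, symmetric in the indices. Each derivative raises the canonical dimension by $1$, and the canonical dimension $\omega$ of a monomial is the sum of those of its factors; an expression has canonical dimension $k$ if it is a combination of monomials of canonical dimension $k$. All expressions are polynomials, with constant (space-time independent) coefficients, in the graded-commuting variables $y^\alpha$ and their derivatives, taken on the mass shell, i.e. modulo the free equations $(d_\mu d^\mu+m_\alpha^2)y^\alpha=0$ ($m_\alpha\ge0$) and their derivatives. "At least tri-linear" means that every monomial has degree at least $3$ in the fields and their derivatives. $I$ denotes an arbitrary collection of additional indices labelling the expressions. *)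

theory Defs
  imports "HOL-Analysis.Analysis" "HOL-Library.Poly_Mapping" "HOL-Library.Multiset"
begin

section \<open>Polynomials in the fields and their derivatives\<close>

text \<open>
  The jet variable \<open>(\<alpha>, {#\<mu>\<^sub>1, \<dots>, \<mu>\<^sub>k#})\<close> stands for
  \<open>y\<^sup>\<alpha>\<^sub>\<mu>\<^sub>1\<^sub>\<dots>\<^sub>\<mu>\<^sub>k\<close>; the multiset makes it symmetric in the indices. The space-time
  indices are the elements \<open>0, 1, 2, 3\<close> of the numeral type \<open>4\<close>.
\<close>

type_synonym 'f jet = "'f \<times> 4 multiset"

text \<open>
  Words in the jet variables form a monoid under concatenation, so that the finitely supported
  functions on words are the free associative algebra over the complex numbers.
  Graded commutativity is imposed below, by passing to a quotient.
\<close>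

instantiation list :: (type) monoid_add
begin

definition zero_list :: "'a list" where "zero_list = []"
definition plus_list :: "'a list \<Rightarrow> 'a list \<Rightarrow> 'a list" where "plus_list = (@)"

instance by standard (simp_all add: zero_list_def plus_list_def)

end

type_synonym 'f expr = "'f jet list \<Rightarrow>\<^sub>0 complex"

definition const :: "complex \<Rightarrow> 'f expr" where
  "const c = Poly_Mapping.single [] c"

definition var :: "'f jet \<Rightarrow> 'f expr" where
  "var v = Poly_Mapping.single [v] 1"

definition basic_field :: "'f \<Rightarrow> 'f expr" where
  "basic_field \<alpha> = var (\<alpha>, {#})"

definition shift :: "4 \<Rightarrow> 'f jet \<Rightarrow> 'f jet" where
  "shift \<mu> v = (fst v, add_mset \<mu> (snd v))"

text \<open>
  The formal derivative \<open>d\<^sub>\<mu>\<close> is the linear extension of the Leibniz rule on words; there are no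
  signs, since \<open>d\<^sub>\<mu>\<close> is an even derivation.
\<close>

definition deriv_word :: "4 \<Rightarrow> 'f jet list \<Rightarrow> 'f expr" where
  "deriv_word \<mu> w = (\<Sum>i<length w. Poly_Mapping.single (w[i := shift \<mu> (w ! i)]) 1)"

definition total_deriv :: "4 \<Rightarrow> 'f expr \<Rightarrow> 'f expr" where
  "total_deriv \<mu> f = (\<Sum>w\<in>Poly_Mapping.keys f. const (Poly_Mapping.lookup f w) * deriv_word \<mu> w)"


section \<open>Graded commutativity and the mass shell\<close>

text \<open>The signature is the one for which \<open>d\<^sub>\<mu> d\<^sup>\<mu> + m\<^sup>2\<close> is the Klein-Gordon operator.\<close>

definition minkowski :: "4 \<Rightarrow> 4 \<Rightarrow> real" where
  "minkowski \<mu> \<nu> = (if \<mu> \<noteq> \<nu> then 0 else if \<mu> = 0 then 1 else - 1)"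

text \<open>
  \<open>gr\<close> tells which of the fields are Grassmann odd. For an odd variable \<open>u = v\<close> the relation
  below is \<open>2 u\<^sup>2\<close>, so that squares of odd variables vanish.
\<close>

definition graded_commutator :: "('f \<Rightarrow> bool) \<Rightarrow> 'f jet \<Rightarrow> 'f jet \<Rightarrow> 'f expr" where
  "graded_commutator gr u v =
     var u * var v - (if gr (fst u) \<and> gr (fst v) then - 1 else 1) * (var v * var u)"

inductive_set free_equations :: "('f \<Rightarrow> real) \<Rightarrow> 'f expr set" for m where
  equation:
    "(\<Sum>\<mu>\<in>UNIV. \<Sum>\<nu>\<in>UNIV.
         const (of_real (minkowski \<mu> \<nu>)) * total_deriv \<mu> (total_deriv \<nu> (basic_field \<alpha>)))
       + const (of_real ((m \<alpha>)\<^sup>2)) * basic_field \<alpha> \<in> free_equations m"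
| derivative: "f \<in> free_equations m \<Longrightarrow> total_deriv \<mu> f \<in> free_equations m"

inductive_set two_sided_ideal :: "'a :: ring_1 set \<Rightarrow> 'a set" for R where
  zero: "0 \<in> two_sided_ideal R"
| add: "f \<in> two_sided_ideal R \<Longrightarrow> g \<in> two_sided_ideal R \<Longrightarrow> f + g \<in> two_sided_ideal R"
| generator: "r \<in> R \<Longrightarrow> a * r * b \<in> two_sided_ideal R"

text \<open>
  Expressions on the mass shell are classes of elements of the free algebra with respect to the
  following relation.
\<close>

definition onshell_eq :: "('f \<Rightarrow> bool) \<Rightarrow> ('f \<Rightarrow> real) \<Rightarrow> 'f expr \<Rightarrow> 'f expr \<Rightarrow> bool" where
  "onshell_eq gr m f g \<longleftrightarrow>
     f - g \<in> two_sided_ideal ({graded_commutator gr u v | u v. True} \<union> free_equations m)"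


section \<open>Canonical dimension and degree\<close>

definition canonical_dim :: "'f jet list \<Rightarrow> nat" where
  "canonical_dim w = (\<Sum>v\<leftarrow>w. 1 + size (snd v))"

text \<open>
  Both notions refer to expressions on the mass shell, hence to some representative of the class.
  For a nonzero mass the free equations are not homogeneous in the canonical dimension, so that
  an expression may have several canonical dimensions.
\<close>

definition has_canonical_dim ::
    "('f \<Rightarrow> bool) \<Rightarrow> ('f \<Rightarrow> real) \<Rightarrow> 'f expr \<Rightarrow> nat \<Rightarrow> bool" where
  "has_canonical_dim gr m f k \<longleftrightarrow>
     (\<exists>g. onshell_eq gr m f g \<and> (\<forall>w\<in>Poly_Mapping.keys g. canonical_dim w = k))"

definition at_least_trilinear ::
    "('f \<Rightarrow> bool) \<Rightarrow> ('f \<Rightarrow> real) \<Rightarrow> 'f expr \<Rightarrow> bool" where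
  "at_least_trilinear gr m f \<longleftrightarrow>
     (\<exists>g. onshell_eq gr m f g \<and> (\<forall>w\<in>Poly_Mapping.keys g. 3 \<le> length w))"

end

theory Submission
  imports Defs
begin

text \<open>
  A word of length \<open>n\<close> with prescribed fields is a monomial in the components of \<open>n\<close> momenta
  \<open>p\<^sub>0, \<dots>, p\<^sub>n\<^sub>-\<^sub>1\<close>. There \<open>d\<^sub>\<mu>\<close> is multiplication by the total momentum
  \<open>q\<^sub>\<mu> = \<Sum>\<^sub>i p\<^sub>i\<^sub>\<mu>\<close>, and the free equations generate the ideal of the mass shells
  \<open>p\<^sub>i\<^sup>2 + m\<^sub>i\<^sup>2\<close>. For \<open>n \<ge> 3\<close> in four dimensions the \<open>q\<^sub>\<mu>\<close> together with the mass shells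
  generate a complete intersection, so that all their syzygies are Koszul syzygies; applied to
  \<open>\<Sum>\<^sub>\<mu> q\<^sub>\<mu> S\<^sup>\<mu> \<in> (p\<^sub>i\<^sup>2 + m\<^sub>i\<^sup>2)\<close> this is the claim before graded commutativity is imposed.
  The graded symmetrizer commutes with \<open>d\<^sub>\<mu>\<close>, maps the full ideal into the one generated by the
  free equations, and is congruent to the identity up to a factor, so it reduces the claim to this case.
\<close>

section \<open>Linear extension\<close>

text \<open>Degree three is the threshold. For two letters, q = 0 forces p_1 = - p_0, so the two
  mass shells differ by a constant and coincide for equal masses. This relation is not a Koszul
  syzygy; it is the origin of currents such as y d_mu y' - y' d_mu y, conserved but not trivial.
  From three letters on, q = 0 eliminates p_2, and the first three shells become quadrics with
  quadratic parts p_0^2, p_1^2 and 2 p_0 p_1 plus terms in later momenta. Their leading monomials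
  can be made coprime by drawing them from three different space-time components. Coprime leading
  monomials for a weight thus replace dimension theory in proving that the generators form a
  complete intersection. Masses enter only through constant terms, of weight 0, so no case
  distinction on them arises. Words are used because a position in a word identifies a momentum: the
  ring of momenta is commutative whatever the parities of the fields.\<close>

lemma poly_mapping_eq_sum_single:
  "f = (\<Sum>k\<in>Poly_Mapping.keys f. Poly_Mapping.single k (Poly_Mapping.lookup f k))"
proof (rule poly_mapping_eqI)
  fix j
  show "Poly_Mapping.lookup f j = Poly_Mapping.lookup
      (\<Sum>k\<in>Poly_Mapping.keys f. Poly_Mapping.single k (Poly_Mapping.lookup f k)) j"
    by (cases "j \<in> Poly_Mapping.keys f")
      (auto simp: lookup_sum lookup_single when_def in_keys_iff)
qed

lemma poly_mapping_single_induct [case_names single add]: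
  assumes "\<And>k v. P (Poly_Mapping.single k v)"
    and "\<And>f g. P f \<Longrightarrow> P g \<Longrightarrow> P (f + g)"
  shows "P (f :: 'a \<Rightarrow>\<^sub>0 'b::comm_monoid_add)"
proof -
  have zero: "P 0"
    using assms(1)[of _ 0] by simp
  have "finite A \<Longrightarrow> P (\<Sum>k\<in>A. Poly_Mapping.single k (Poly_Mapping.lookup f k))" for A
    by (induction A rule: finite_induct) (auto intro: assms zero)
  then show ?thesis
    by (subst poly_mapping_eq_sum_single) simp
qed

text \<open>The unit 0 is the empty word in the free algebra and the empty multiset in the
  polynomial ring of the momenta, so one notation for constants serves both.\<close>

abbreviation scalar :: "'c \<Rightarrow> 'a::zero \<Rightarrow>\<^sub>0 'c::zero" where
  "scalar c \<equiv> Poly_Mapping.single 0 c"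

lemma scalar_commute: "scalar c * f = f * (scalar c :: 'a::monoid_add \<Rightarrow>\<^sub>0 'c::comm_semiring_0)"
  by (induction f rule: poly_mapping_single_induct)
    (simp_all add: mult_single distrib_left distrib_right mult.commute)

lemma scalar_left_commute:
  "f * (scalar c * g) = scalar c * (f * g)" for c :: "'c::comm_semiring_0"
  by (simp only: mult.assoc[symmetric] scalar_commute[of c f])

lemma lookup_scalar_mult:
  "Poly_Mapping.lookup (scalar c * f) w = c * Poly_Mapping.lookup f w"
  for c :: "'c::semiring_0" and f :: "'a::monoid_add \<Rightarrow>\<^sub>0 'c"
  by (induction f rule: poly_mapping_single_induct)
    (simp_all add: mult_single distrib_left lookup_add lookup_single when_def)

lemma keys_scalar_mult: "Poly_Mapping.keys (scalar c * f) \<subseteq> Poly_Mapping.keys f"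
  for c :: "'c::semiring_0" and f :: "'a::monoid_add \<Rightarrow>\<^sub>0 'c"
  by (auto simp: in_keys_iff lookup_scalar_mult)

definition lin_ext ::
    "('a \<Rightarrow> 'b::monoid_add \<Rightarrow>\<^sub>0 'c) \<Rightarrow> ('a \<Rightarrow>\<^sub>0 'c) \<Rightarrow> 'b \<Rightarrow>\<^sub>0 'c::comm_ring_1" where
  "lin_ext g f = (\<Sum>w\<in>Poly_Mapping.keys f. scalar (Poly_Mapping.lookup f w) * g w)"

lemma lin_ext_superset:
  assumes "finite A" "Poly_Mapping.keys f \<subseteq> A"
  shows "lin_ext g f = (\<Sum>w\<in>A. scalar (Poly_Mapping.lookup f w) * g w)"
  unfolding lin_ext_def using assms
  by (intro sum.mono_neutral_left) (auto simp: in_keys_iff)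

lemma lin_ext_zero [simp]: "lin_ext g 0 = 0"
  by (simp add: lin_ext_def)

lemma lin_ext_single [simp]: "lin_ext g (Poly_Mapping.single w c) = scalar c * g w"
  by (simp add: lin_ext_def)

lemma lin_ext_add [simp]: "lin_ext g (f + h) = lin_ext g f + lin_ext g h"
proof -
  let ?A = "Poly_Mapping.keys f \<union> Poly_Mapping.keys h"
  have "lin_ext g (f + h) = (\<Sum>w\<in>?A. scalar (Poly_Mapping.lookup (f + h) w) * g w)"
    by (rule lin_ext_superset) (use keys_add[of f h] in auto)
  also have "\<dots> = (\<Sum>w\<in>?A. scalar (Poly_Mapping.lookup f w) * g w)
      + (\<Sum>w\<in>?A. scalar (Poly_Mapping.lookup h w) * g w)"
    by (simp add: lookup_add single_add distrib_right sum.distrib)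
  also have "\<dots> = lin_ext g f + lin_ext g h"
    by (simp add: lin_ext_superset[of ?A])
  finally show ?thesis .
qed

lemma lin_ext_uminus [simp]: "lin_ext g (- f) = - lin_ext g f"
  by (simp add: lin_ext_def single_uminus sum_negf)

lemma lin_ext_diff [simp]: "lin_ext g (f - h) = lin_ext g f - lin_ext g h"
  using lin_ext_add[of g f "- h"] by simp

lemma lin_ext_sum: "lin_ext g (\<Sum>i\<in>A. f i) = (\<Sum>i\<in>A. lin_ext g (f i))"
  by (induction A rule: infinite_finite_induct) auto

lemma lin_ext_scalar_mult [simp]: "lin_ext g (scalar c * f) = scalar c * lin_ext g f"
  by (induction f rule: poly_mapping_single_induct)
    (simp_all add: mult_single distrib_left flip: mult.assoc)

lemma lin_ext_lin_ext: "lin_ext g (lin_ext h f) = lin_ext (\<lambda>w. lin_ext g (h w)) f"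
  by (induction f rule: poly_mapping_single_induct) simp_all

lemma lin_ext_cong:
  "(\<And>w. w \<in> Poly_Mapping.keys f \<Longrightarrow> g w = h w) \<Longrightarrow> lin_ext g f = lin_ext h f"
  by (simp add: lin_ext_def)

lemma keys_lin_ext:
  "Poly_Mapping.keys (lin_ext g f) \<subseteq> (\<Union>w\<in>Poly_Mapping.keys f. Poly_Mapping.keys (g w))"
proof -
  have "Poly_Mapping.keys (lin_ext g f)
      \<subseteq> (\<Union>w\<in>Poly_Mapping.keys f. Poly_Mapping.keys (scalar (Poly_Mapping.lookup f w) * g w))"
    unfolding lin_ext_def by (rule keys_sum)
  then show ?thesis
    using keys_scalar_mult by fastforce
qed

lemma lin_ext_sum_family:
  "lin_ext (\<lambda>w. \<Sum>i\<in>A. g i w) f = (\<Sum>i\<in>A. lin_ext (g i) f)"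
  by (simp add: lin_ext_def sum_distrib_left sum.swap[of _ A])

lemma lin_ext_scalar_family: "lin_ext (\<lambda>w. scalar c * g w) f = scalar c * lin_ext g f"
  by (simp only: lin_ext_def sum_distrib_left scalar_left_commute[of _ c])

section \<open>The free algebra\<close>

lemma const_eq_scalar: "const c = scalar c"
  by (simp add: const_def zero_list_def)

lemma var_mult_single: "var v * Poly_Mapping.single w c = Poly_Mapping.single (v # w) c"
  by (simp add: var_def mult_single plus_list_def)

lemma single_Cons: "Poly_Mapping.single (v # w) c = var v * Poly_Mapping.single w c"
  by (simp add: var_mult_single)

lemma single_Nil: "Poly_Mapping.single [] c = scalar c"
  by (simp add: zero_list_def)

lemma single_append:
  "Poly_Mapping.single (u @ w) (c :: complex) = Poly_Mapping.single u 1 * Poly_Mapping.single w c"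
  by (simp add: mult_single plus_list_def)

text \<open>Linear statements reduce to constants and to left multiplication by one letter, which
  matches the recursion of the derivative and of the symmetrizer on words.\<close>

lemma expr_word_induct [case_names scalar var add]:
  assumes "\<And>c. P (scalar c)"
    and "\<And>v f. P f \<Longrightarrow> P (var v * f)"
    and "\<And>f g. P f \<Longrightarrow> P g \<Longrightarrow> P (f + g)"
  shows "P (f :: 'f expr)"
proof (induction f rule: poly_mapping_single_induct)
  case (single w c)
  show ?case
    by (induction w) (auto simp: single_Nil single_Cons assms)
qed (rule assms)

lemma total_deriv_eq_lin_ext: "total_deriv \<mu> = lin_ext (deriv_word \<mu>)"
  by (auto simp: total_deriv_def lin_ext_def const_eq_scalar)

lemma deriv_word_Nil [simp]: "deriv_word \<mu> [] = 0"
  by (simp add: deriv_word_def)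

lemma deriv_word_zero: "deriv_word \<mu> 0 = 0"
  by (simp add: zero_list_def)

lemma deriv_word_Cons:
  "deriv_word \<mu> (v # w) = Poly_Mapping.single (shift \<mu> v # w) 1 + var v * deriv_word \<mu> w"
  unfolding deriv_word_def
  by (simp add: sum.lessThan_Suc_shift var_mult_single sum_distrib_left del: sum.lessThan_Suc)

lemma total_deriv_add [simp]: "total_deriv \<mu> (f + g) = total_deriv \<mu> f + total_deriv \<mu> g"
  and total_deriv_diff [simp]: "total_deriv \<mu> (f - g) = total_deriv \<mu> f - total_deriv \<mu> g"
  and total_deriv_zero [simp]: "total_deriv \<mu> 0 = 0"
  and total_deriv_scalar [simp]: "total_deriv \<mu> (scalar c) = 0"
  and total_deriv_scalar_mult [simp]: "total_deriv \<mu> (scalar c * f) = scalar c * total_deriv \<mu> f"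
  and total_deriv_sum: "total_deriv \<mu> (\<Sum>i\<in>A. h i) = (\<Sum>i\<in>A. total_deriv \<mu> (h i))"
  by (simp_all add: total_deriv_eq_lin_ext lin_ext_sum deriv_word_zero)

lemma total_deriv_var [simp]: "total_deriv \<mu> (var v) = var (shift \<mu> v)"
  by (simp add: var_def total_deriv_eq_lin_ext deriv_word_Cons)

lemma total_deriv_var_mult:
  "total_deriv \<mu> (var v * f) = var (shift \<mu> v) * f + var v * total_deriv \<mu> f"
proof (induction f rule: poly_mapping_single_induct)
  case (single w c)
  have "total_deriv \<mu> (var v * Poly_Mapping.single w c)
      = scalar c * Poly_Mapping.single (shift \<mu> v # w) 1 + scalar c * var v * deriv_word \<mu> w"
    by (simp add: var_mult_single total_deriv_eq_lin_ext deriv_word_Cons distrib_left mult.assoc)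
  also have "\<dots> = var (shift \<mu> v) * Poly_Mapping.single w c
      + var v * total_deriv \<mu> (Poly_Mapping.single w c)"
    by (simp add: var_mult_single total_deriv_eq_lin_ext mult_single mult.assoc flip: scalar_commute)
       (simp only: scalar_left_commute mult.assoc)
  finally show ?case .
qed (simp add: algebra_simps)

lemma total_deriv_mult: "total_deriv \<mu> (f * g) = total_deriv \<mu> f * g + f * total_deriv \<mu> g"
  by (induction f rule: expr_word_induct)
    (simp_all add: total_deriv_var_mult algebra_simps)

section \<open>The ideals\<close>

lemma two_sided_ideal_sum:
  "(\<And>i. i \<in> A \<Longrightarrow> f i \<in> two_sided_ideal R) \<Longrightarrow> (\<Sum>i\<in>A. f i) \<in> two_sided_ideal R"
  by (induction A rule: infinite_finite_induct)
    (auto intro: two_sided_ideal.zero two_sided_ideal.add)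

lemma two_sided_ideal_mult:
  "f \<in> two_sided_ideal R \<Longrightarrow> a * f * b \<in> two_sided_ideal R"
proof (induction rule: two_sided_ideal.induct)
  case (generator r a' b')
  then show ?case
    using two_sided_ideal.generator[of r R "a * a'" "b' * b"] by (simp add: mult.assoc)
qed (auto simp: distrib_left distrib_right intro: two_sided_ideal.zero two_sided_ideal.add)

lemma two_sided_ideal_mult_left: "f \<in> two_sided_ideal R \<Longrightarrow> a * f \<in> two_sided_ideal R"
  using two_sided_ideal_mult[of f R a 1] by simp

lemma two_sided_ideal_mult_right: "f \<in> two_sided_ideal R \<Longrightarrow> f * a \<in> two_sided_ideal R"
  using two_sided_ideal_mult[of f R 1 a] by simp

lemma two_sided_ideal_uminus: "f \<in> two_sided_ideal R \<Longrightarrow> - f \<in> two_sided_ideal R"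
  using two_sided_ideal_mult_left[of f R "- 1"] by simp

lemma two_sided_ideal_diff:
  "f \<in> two_sided_ideal R \<Longrightarrow> g \<in> two_sided_ideal R \<Longrightarrow> f - g \<in> two_sided_ideal R"
  using two_sided_ideal.add[OF _ two_sided_ideal_uminus] by fastforce

lemma two_sided_ideal_base: "r \<in> R \<Longrightarrow> r \<in> two_sided_ideal R"
  using two_sided_ideal.generator[of r R 1 1] by simp

lemma two_sided_ideal_mono:
  assumes "R \<subseteq> R'"
  shows "two_sided_ideal R \<subseteq> two_sided_ideal R'"
proof
  fix f assume "f \<in> two_sided_ideal R"
  then show "f \<in> two_sided_ideal R'"
    by induction (use assms in \<open>auto intro: two_sided_ideal.intros\<close>)
qed

text \<open>Both cofactors are expanded in words and their coefficients collected in front. A linear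
  map can then be followed letter by letter through the word to the left of the generator.\<close>

lemma two_sided_ideal_word_induct [consumes 1, case_names zero add generator]:
  assumes "f \<in> two_sided_ideal R"
    and zero: "P 0"
    and add: "\<And>f g. P f \<Longrightarrow> P g \<Longrightarrow> P (f + g)"
    and gen: "\<And>r u c w. r \<in> R \<Longrightarrow>
      P (scalar c * (Poly_Mapping.single u 1 * (r * Poly_Mapping.single w 1)))"
  shows "P (f :: 'f expr)"
  using assms(1)
proof induction
  case (generator r a b)
  have "P (Poly_Mapping.single u c * r * b)" for u c
  proof (induction b rule: poly_mapping_single_induct)
    case (single w d)
    have "Poly_Mapping.single u c * r * Poly_Mapping.single w d
        = scalar (c * d) * (Poly_Mapping.single u 1 * (r * Poly_Mapping.single w 1))"
    proof -
      have "Poly_Mapping.single u c * r * Poly_Mapping.single w d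
        = scalar c * Poly_Mapping.single u 1 * r * (scalar d * Poly_Mapping.single w 1)"
        by (simp add: mult_single)
      also have "\<dots> = scalar c * ((Poly_Mapping.single u 1 * r) * scalar d) * Poly_Mapping.single w 1"
        by (simp add: mult.assoc)
      also have "\<dots> = scalar c * (scalar d * (Poly_Mapping.single u 1 * r)) * Poly_Mapping.single w 1"
        by (simp only: scalar_commute)
      also have "\<dots> = (scalar c * scalar d) * (Poly_Mapping.single u 1 * (r * Poly_Mapping.single w 1))"
        by (simp only: mult.assoc)
      finally show ?thesis
        by (simp add: mult_single)
    qed
    then show ?case
      using gen[OF generator] by simp
  qed (simp add: distrib_left add)
  then show ?case
    by (induction a rule: poly_mapping_single_induct) (simp_all add: distrib_right add)
qed (auto intro: zero add)

section \<open>Koszul syzygies\<close>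

lemma keys_sumE:
  assumes "M \<in> Poly_Mapping.keys (\<Sum>i\<in>A. f i)"
  obtains i where "i \<in> A" "M \<in> Poly_Mapping.keys (f i)"
  using assms keys_sum[of f A] by blast

text \<open>In a general group antisymmetry does not force the diagonal to vanish, hence the second
  clause.\<close>

definition alternating :: "('k \<Rightarrow> 'k \<Rightarrow> 'a::group_add) \<Rightarrow> bool" where
  "alternating t \<longleftrightarrow> (\<forall>k j. t k j = - t j k) \<and> (\<forall>k. t k k = 0)"

text \<open>Vanishing of the first Koszul homology: all syzygies are generated by the trivial ones
  f_j e_k - f_k e_j.\<close>

definition koszul_exact :: "'k set \<Rightarrow> ('k \<Rightarrow> 'a::comm_ring_1) \<Rightarrow> bool" where
  "koszul_exact K f \<longleftrightarrow> (\<forall>x. (\<Sum>k\<in>K. f k * x k) = 0 \<longrightarrow>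
     (\<exists>t. alternating t \<and> (\<forall>k\<in>K. x k = (\<Sum>j\<in>K. f j * t k j))))"

lemma sum_alternating_eq_0:
  fixes t :: "'k \<Rightarrow> 'k \<Rightarrow> 'a::comm_monoid_add \<Rightarrow>\<^sub>0 'c::field_char_0"
  assumes "alternating t"
  shows "(\<Sum>k\<in>K. f k * (\<Sum>j\<in>K. f j * t k j)) = 0"
proof -
  let ?s = "\<Sum>k\<in>K. f k * (\<Sum>j\<in>K. f j * t k j)"
  have "?s = (\<Sum>k\<in>K. \<Sum>j\<in>K. f k * f j * t k j)"
    by (simp add: sum_distrib_left mult.assoc)
  also have "\<dots> = (\<Sum>j\<in>K. \<Sum>k\<in>K. f k * f j * t k j)"
    by (rule sum.swap)
  also have "\<dots> = (\<Sum>j\<in>K. \<Sum>k\<in>K. - (f j * f k * t j k))"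
  proof (intro sum.cong refl)
    fix j k
    have "t k j = - t j k"
      using assms unfolding alternating_def by blast
    then show "f k * f j * t k j = - (f j * f k * t j k)"
      by (simp add: mult.commute)
  qed
  also have "\<dots> = - ?s"
    by (simp add: sum_distrib_left mult.assoc sum_negf)
  finally have s: "?s + ?s = 0"
    by simp
  \<comment> \<open>The factor 2 is cancelled in the coefficient field, monomial by
    monomial.\<close>
  have "Poly_Mapping.lookup ?s M + Poly_Mapping.lookup ?s M = 0" for M
    using arg_cong[OF s, of "\<lambda>p. Poly_Mapping.lookup p M"] by (simp only: lookup_add lookup_zero)
  then show ?thesis
    by (intro poly_mapping_eqI) simp
qed

text \<open>Adding to one generator a combination of the others is an invertible change of
  generators. Syzygies of the new family correspond to syzygies \<open>x k + G k * x a\<close> of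
  the old one, and \<open>G a = 0\<close> keeps the entry at \<open>a\<close> unchanged.\<close>

lemma koszul_exact_change_generator:
  assumes "koszul_exact K f" "finite K" "a \<in> K" "G a = 0"
  shows "koszul_exact K (\<lambda>k. if k = a then f a + (\<Sum>b\<in>K. G b * f b) else f k)"
  unfolding koszul_exact_def
proof (intro allI impI)
  fix x
  let ?f = "\<lambda>k. if k = a then f a + (\<Sum>b\<in>K. G b * f b) else f k"
  have split: "(\<Sum>k\<in>K. ?f k * y k) = (\<Sum>k\<in>K. f k * y k) + (\<Sum>b\<in>K. G b * f b) * y a" for y
    using assms(2,3) by (simp add: sum.remove[of K a] distrib_right)
  assume "(\<Sum>k\<in>K. ?f k * x k) = 0"
  then have "(\<Sum>k\<in>K. f k * x k) + (\<Sum>b\<in>K. G b * f b) * x a = 0"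
    by (simp only: split)
  then have "(\<Sum>k\<in>K. f k * (x k + G k * x a)) = 0"
    by (simp add: sum.distrib algebra_simps sum_distrib_left)
  then obtain t where t: "alternating t"
    and x: "\<And>k. k \<in> K \<Longrightarrow> x k + G k * x a = (\<Sum>j\<in>K. f j * t k j)"
    using assms(1)[unfolded koszul_exact_def, rule_format, of "\<lambda>k. x k + G k * x a"] by blast
  have anti: "t k j = - t j k" "t k k = 0" for k j
    using t unfolding alternating_def by blast+
  \<comment> \<open>The inverse change of generators applied to both indices of \<open>t\<close>;
    the term with \<open>t a a\<close> drops out.\<close>
  define t' where "t' = (\<lambda>k j. t k j - G j * t k a + G k * t j a)"
  have "t' k j = - t' j k" for k j
    using anti(1)[of k j] unfolding t'_def by simp
  moreover have "t' k k = 0" for k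
    by (simp add: t'_def anti(2))
  ultimately have "alternating t'"
    unfolding alternating_def by blast
  moreover have "x k = (\<Sum>j\<in>K. ?f j * t' k j)" if "k \<in> K" for k
  proof -
    have "(\<Sum>j\<in>K. f j * t j a) = - (\<Sum>j\<in>K. f j * t a j)"
      by (subst anti(1)) (simp add: sum_negf)
    also have "\<dots> = - x a"
      using x[OF assms(3)] assms(4) by simp
    finally have *: "(\<Sum>j\<in>K. f j * t j a) = - x a" .
    have "(\<Sum>j\<in>K. f j * t' k j) = (\<Sum>j\<in>K. f j * t k j)
        - (\<Sum>b\<in>K. G b * f b) * t k a + G k * (\<Sum>j\<in>K. f j * t j a)"
      by (simp add: t'_def algebra_simps sum.distrib sum_subtractf sum_distrib_left)
    also have "\<dots> = x k - (\<Sum>b\<in>K. G b * f b) * t k a"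
      by (simp add: * flip: x[OF that])
    finally show ?thesis
      by (simp add: split t'_def anti(2) assms(4))
  qed
  ultimately show "\<exists>t. alternating t \<and> (\<forall>k\<in>K. x k = (\<Sum>j\<in>K. ?f j * t k j))"
    by blast
qed

section \<open>Syzygies of pairwise coprime monomials\<close>

lemma subset_mset_add_disjoint:
  assumes "A \<subseteq># B + M" "A \<inter># B = {#}"
  shows "A \<subseteq># M"
proof (rule mset_subset_eqI)
  fix v
  have "min (count A v) (count B v) = 0"
    using arg_cong[OF assms(2), of "\<lambda>X. count X v"] by simp
  moreover have "count A v \<le> count B v + count M v"
    using mset_subset_eq_count[OF assms(1), of v] by simp
  ultimately show "count A v \<le> count M v"
    by (auto simp: min_def split: if_splits)
qed

lemma lookup_single_mult:
  "Poly_Mapping.lookup (Poly_Mapping.single l c * f) (l + M) = c * Poly_Mapping.lookup f M"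
  for l :: "'a::cancel_comm_monoid_add" and c :: "'c::semiring_0"
  by (induction f rule: poly_mapping_single_induct)
    (auto simp: mult_single distrib_left lookup_add lookup_single when_def)

text \<open>Each monomial of \<open>x\<close> is assigned to a single divisor, so nothing cancels
  between the summands. The second conclusion follows from this and lets homogeneity pass from
  \<open>x\<close> to the quotients.\<close>

lemma monomial_ideal_division:
  fixes x :: "'v multiset \<Rightarrow>\<^sub>0 'c::field"
  assumes "finite K" "\<And>k. k \<in> K \<Longrightarrow> c k \<noteq> 0"
    and "\<And>M. M \<in> Poly_Mapping.keys x \<Longrightarrow> \<exists>k\<in>K. l k \<subseteq># M"
  shows "\<exists>y. x = (\<Sum>k\<in>K. Poly_Mapping.single (l k) (c k) * y k)
    \<and> (\<forall>k. \<forall>M\<in>Poly_Mapping.keys (y k). M + l k \<in> Poly_Mapping.keys x)"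
proof -
  obtain \<kappa> where \<kappa>: "\<And>M. M \<in> Poly_Mapping.keys x \<Longrightarrow> \<kappa> M \<in> K \<and> l (\<kappa> M) \<subseteq># M"
    using assms(3) by metis
  define A where "A k = {M \<in> Poly_Mapping.keys x. \<kappa> M = k}" for k
  define y where
    "y k = (\<Sum>M\<in>A k. Poly_Mapping.single (M - l k) (Poly_Mapping.lookup x M / c k))" for k
  have "(\<Sum>k\<in>K. Poly_Mapping.single (l k) (c k) * y k)
      = (\<Sum>k\<in>K. \<Sum>M\<in>A k. Poly_Mapping.single M (Poly_Mapping.lookup x M))"
    unfolding y_def sum_distrib_left
    by (intro sum.cong refl) (use \<kappa> in \<open>auto simp: A_def mult_single assms(2)\<close>)
  also have "\<dots> = x"
    unfolding A_def using \<kappa> poly_mapping_eq_sum_single[of x]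
    by (subst sum.group) (auto simp: assms(1))
  finally have "x = (\<Sum>k\<in>K. Poly_Mapping.single (l k) (c k) * y k)" ..
  moreover have "M + l k \<in> Poly_Mapping.keys x" if "M \<in> Poly_Mapping.keys (y k)" for k M
  proof -
    from that
    obtain N where "N \<in> A k"
        "M \<in> Poly_Mapping.keys (Poly_Mapping.single (N - l k) (Poly_Mapping.lookup x N / c k))"
      unfolding y_def by (rule keys_sumE)
    then show ?thesis
      using \<kappa>[of N] by (auto simp: A_def split: if_splits)
  qed
  ultimately show ?thesis
    by blast
qed

text \<open>
  The property \<open>P\<close> of products records that \<open>t\<close> may be chosen homogeneous when \<open>x\<close> is.
\<close>

lemma koszul_exact_monomials:
  fixes x :: "'k \<Rightarrow> 'v multiset \<Rightarrow>\<^sub>0 'c::field"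
  assumes "finite K" "\<And>k. k \<in> K \<Longrightarrow> c k \<noteq> 0"
    and "\<And>k j. k \<in> K \<Longrightarrow> j \<in> K \<Longrightarrow> k \<noteq> j \<Longrightarrow> l k \<inter># l j = {#}"
    and "(\<Sum>k\<in>K. Poly_Mapping.single (l k) (c k) * x k) = 0"
    and "\<And>k M. k \<in> K \<Longrightarrow> M \<in> Poly_Mapping.keys (x k) \<Longrightarrow> P (M + l k)"
  shows "\<exists>t. alternating t
    \<and> (\<forall>k\<in>K. x k = (\<Sum>j\<in>K. Poly_Mapping.single (l j) (c j) * t k j))
    \<and> (\<forall>k j. \<forall>M\<in>Poly_Mapping.keys (t k j). P (M + l k + l j))"
  using assms
proof (induction K arbitrary: x rule: finite_induct)
  case empty
  show ?case
    by (rule exI[of _ "\<lambda>_ _. 0"]) (simp add: alternating_def)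
next
  case (insert a K)
  let ?L = "\<lambda>k. Poly_Mapping.single (l k) (c k)"
  have c: "c k \<noteq> 0" if "k \<in> insert a K" for k
    using insert.prems(1) that by blast
  have eq: "?L a * x a = - (\<Sum>k\<in>K. ?L k * x k)"
    using insert.prems(3) insert.hyps by (simp add: eq_neg_iff_add_eq_0)
  \<comment> \<open>A monomial of \<open>l a * x a\<close> must also occur on the other side, so
    some \<open>l k\<close> divides it; being coprime to \<open>l a\<close>, this \<open>l k\<close>
    divides the factor from \<open>x a\<close>.\<close>
  have div: "\<exists>k\<in>K. l k \<subseteq># M" if M: "M \<in> Poly_Mapping.keys (x a)" for M
  proof -
    have "l a + M \<in> Poly_Mapping.keys (?L a * x a)"
      using M c by (simp add: in_keys_iff lookup_single_mult)
    then have "l a + M \<in> Poly_Mapping.keys (\<Sum>k\<in>K. ?L k * x k)"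
      by (simp add: eq in_keys_iff)
    then obtain k where k: "k \<in> K" "l a + M \<in> Poly_Mapping.keys (?L k * x k)"
      by (rule keys_sumE)
    then obtain N where "l a + M = l k + N"
      using keys_mult[of "?L k" "x k"] by (auto split: if_splits)
    then have "l k \<subseteq># l a + M"
      by simp
    moreover have "l k \<inter># l a = {#}"
      using insert.prems(2)[of k a] k insert.hyps by auto
    ultimately have "l k \<subseteq># M"
      by (rule subset_mset_add_disjoint)
    then show ?thesis
      using k by blast
  qed
  have cK: "c k \<noteq> 0" if "k \<in> K" for k
    using c that by blast
  obtain y where y: "x a = (\<Sum>k\<in>K. ?L k * y k)"
    and keys_y: "\<And>k M. M \<in> Poly_Mapping.keys (y k) \<Longrightarrow> M + l k \<in> Poly_Mapping.keys (x a)"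
    using monomial_ideal_division[where x = "x a" and l = l and c = c, OF insert.hyps(1) cK div] by blast
  \<comment> \<open>Inserting the decomposition of \<open>x a\<close> turns the relation into one
    over \<open>K\<close> alone, with these coefficients.\<close>
  define z where "z k = x k + ?L a * y k" for k
  have "(\<Sum>k\<in>K. ?L k * z k) = (\<Sum>k\<in>K. ?L k * x k) + ?L a * (\<Sum>k\<in>K. ?L k * y k)"
    by (simp add: z_def distrib_left sum.distrib sum_distrib_left mult.left_commute)
  also have "\<dots> = 0"
    using eq by (simp flip: y)
  finally have z0: "(\<Sum>k\<in>K. ?L k * z k) = 0" .
  have Py: "P (M + l k + l a)" if "M \<in> Poly_Mapping.keys (y k)" for k M
    using insert.prems(4)[OF _ keys_y[OF that]] by simp
  have Pz: "P (M + l k)" if "k \<in> K" "M \<in> Poly_Mapping.keys (z k)" for k M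
  proof -
    have "M \<in> Poly_Mapping.keys (x k) \<or> M \<in> Poly_Mapping.keys (?L a * y k)"
      using that(2) keys_add[of "x k" "?L a * y k"] unfolding z_def by blast
    then show ?thesis
    proof
      assume "M \<in> Poly_Mapping.keys (?L a * y k)"
      then obtain N where "M = l a + N" "N \<in> Poly_Mapping.keys (y k)"
        using keys_mult[of "?L a" "y k"] by (auto split: if_splits)
      then show ?thesis
        using Py[of N k] by (simp add: ac_simps)
    qed (use that insert.prems(4) in auto)
  qed
  have "\<exists>t. alternating t \<and> (\<forall>k\<in>K. z k = (\<Sum>j\<in>K. ?L j * t k j))
      \<and> (\<forall>k j. \<forall>M\<in>Poly_Mapping.keys (t k j). P (M + l k + l j))"
    by (rule insert.IH) (use c insert.prems(2) z0 Pz in auto)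
  then obtain t where anti: "\<And>k j. t k j = - t j k" "\<And>k. t k k = 0"
    and z: "\<And>k. k \<in> K \<Longrightarrow> z k = (\<Sum>j\<in>K. ?L j * t k j)"
    and Pt: "\<And>k j M. M \<in> Poly_Mapping.keys (t k j) \<Longrightarrow> P (M + l k + l j)"
    unfolding alternating_def by blast
  \<comment> \<open>The quotients \<open>y\<close> fill the row of \<open>a\<close>. Its column,
    with the opposite sign, undoes the correction that led from \<open>x\<close> to
    \<open>z\<close>.\<close>
  define t' where "t' = (\<lambda>k j. if k = a then if j = a then 0 else y j
      else if j = a then - y k else t k j)"
  have "alternating t'"
    unfolding alternating_def t'_def by (auto simp: anti(2) intro: anti(1))
  moreover have "x k = (\<Sum>j\<in>insert a K. ?L j * t' k j)" if "k \<in> insert a K" for k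
  proof (cases "k = a")
    case True
    have "(\<Sum>j\<in>K. ?L j * t' a j) = (\<Sum>j\<in>K. ?L j * y j)"
      using insert.hyps by (intro sum.cong) (auto simp: t'_def)
    then show ?thesis
      using True insert.hyps y by (simp add: t'_def)
  next
    case False
    have "(\<Sum>j\<in>K. ?L j * t' k j) = (\<Sum>j\<in>K. ?L j * t k j)"
      using insert.hyps False by (intro sum.cong) (auto simp: t'_def)
    also have "\<dots> = z k"
      using False that z by simp
    finally show ?thesis
      using False insert.hyps by (simp add: t'_def z_def)
  qed
  moreover have "P (M + l k + l j)" if "M \<in> Poly_Mapping.keys (t' k j)" for k j M
    using that Py[of M j] Py[of M k] Pt[of M k j]
    by (auto simp: t'_def ac_simps split: if_splits)
  ultimately show ?case
    by blast
qed

section \<open>Lifting syzygies from the leading monomials\<close>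

lemma poly_mapping_split:
  fixes f :: "'a \<Rightarrow>\<^sub>0 'b::comm_monoid_add"
  obtains g h where "f = g + h" "Poly_Mapping.keys g = Poly_Mapping.keys f \<inter> A"
    "Poly_Mapping.keys h = Poly_Mapping.keys f - A"
proof -
  let ?r = "\<lambda>B. \<Sum>k\<in>Poly_Mapping.keys f \<inter> B. Poly_Mapping.single k (Poly_Mapping.lookup f k)"
  have l: "Poly_Mapping.lookup (?r B) k = (if k \<in> B then Poly_Mapping.lookup f k else 0)" for B k
    by (auto simp: lookup_sum lookup_single when_def in_keys_iff)
  show thesis
    by (rule that[of "?r A" "?r (- A)"])
      (auto intro!: poly_mapping_eqI simp: lookup_add l in_keys_iff split: if_splits)
qed

text \<open>
  Pairwise coprime leading monomials: every S-polynomial reduces to zero by Buchberger's first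
  criterion, and the syzygies of the leading monomials lift.
\<close>

theorem koszul_exact_coprime_leading:
  fixes h :: "'k \<Rightarrow> 'v multiset \<Rightarrow>\<^sub>0 'c::field_char_0" and wt :: "'v multiset \<Rightarrow> nat"
  assumes "finite K" "\<And>k. k \<in> K \<Longrightarrow> c k \<noteq> 0"
    and "\<And>k j. k \<in> K \<Longrightarrow> j \<in> K \<Longrightarrow> k \<noteq> j \<Longrightarrow> l k \<inter># l j = {#}"
    and wt: "\<And>M N. wt (M + N) = wt M + wt N"
    and h: "\<And>k M. k \<in> K \<Longrightarrow> M \<in> Poly_Mapping.keys (h k) \<Longrightarrow> wt M < wt (l k)"
  shows "koszul_exact K (\<lambda>k. Poly_Mapping.single (l k) (c k) + h k)"
  unfolding koszul_exact_def
proof (intro allI impI)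
  let ?L = "\<lambda>k. Poly_Mapping.single (l k) (c k)"
  let ?f = "\<lambda>k. ?L k + h k"
  \<comment> \<open>Induction on a strict bound for the weights occurring in the products of
    \<open>l k\<close> and \<open>x k\<close>: each round removes the top weight by subtracting a
    Koszul syzygy.\<close>
  have lift: "(\<Sum>k\<in>K. ?f k * x k) = 0 \<Longrightarrow>
      (\<And>k M. k \<in> K \<Longrightarrow> M \<in> Poly_Mapping.keys (x k) \<Longrightarrow> wt M + wt (l k) < W) \<Longrightarrow>
      \<exists>t. alternating t \<and> (\<forall>k\<in>K. x k = (\<Sum>j\<in>K. ?f j * t k j))" for x W
  proof (induction W arbitrary: x)
    case 0
    have "x k = 0" if "k \<in> K" for k
      using 0(2)[OF that] by (metis keys_eq_empty all_not_in_conv not_less0)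
    then show ?case
      by (intro exI[of _ "\<lambda>_ _. 0"]) (simp add: alternating_def)
  next
    case (Suc W)
    have "\<exists>g r. x k = g + r
        \<and> Poly_Mapping.keys g = Poly_Mapping.keys (x k) \<inter> {M. wt M + wt (l k) = W}
        \<and> Poly_Mapping.keys r = Poly_Mapping.keys (x k) - {M. wt M + wt (l k) = W}" for k
      by (rule poly_mapping_split) blast
    then obtain top low where x: "\<And>k. x k = top k + low k"
      and top: "\<And>k. Poly_Mapping.keys (top k)
        = Poly_Mapping.keys (x k) \<inter> {M. wt M + wt (l k) = W}"
      and low: "\<And>k. Poly_Mapping.keys (low k)
        = Poly_Mapping.keys (x k) - {M. wt M + wt (l k) = W}"
      by metis
    have wt_low: "wt M + wt (l k) < W" if "k \<in> K" "M \<in> Poly_Mapping.keys (low k)" for k M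
      using Suc.prems(2)[of k M] that low by fastforce
    let ?A = "\<Sum>k\<in>K. ?L k * top k" and ?B = "\<Sum>k\<in>K. ?L k * low k + h k * x k"
    have "?A + ?B = (\<Sum>k\<in>K. ?f k * x k)"
      unfolding sum.distrib[symmetric] by (intro sum.cong refl) (simp add: x algebra_simps)
    with Suc.prems(1) have "?A + ?B = 0"
      by simp
    from arg_cong[OF this, of Poly_Mapping.lookup]
    have AB: "Poly_Mapping.lookup ?A M = - Poly_Mapping.lookup ?B M" for M
      by (simp only: fun_eq_iff lookup_add lookup_zero eq_neg_iff_add_eq_0)
    have A: "wt M = W" if M: "M \<in> Poly_Mapping.keys ?A" for M
    proof -
      obtain k where "k \<in> K" "M \<in> Poly_Mapping.keys (?L k * top k)"
        using M by (rule keys_sumE)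
      then obtain N where "M = l k + N" "N \<in> Poly_Mapping.keys (top k)"
        using keys_mult[of "?L k" "top k"] by (auto split: if_splits)
      then show ?thesis
        using top by (auto simp: wt)
    qed
    have B: "wt M < W" if M: "M \<in> Poly_Mapping.keys ?B" for M
    proof -
      obtain k where k: "k \<in> K" "M \<in> Poly_Mapping.keys (?L k * low k + h k * x k)"
        using M by (rule keys_sumE)
      then consider "M \<in> Poly_Mapping.keys (?L k * low k)" | "M \<in> Poly_Mapping.keys (h k * x k)"
        using keys_add[of "?L k * low k" "h k * x k"] by blast
      then show ?thesis
      proof cases
        case 1
        then obtain N where "M = l k + N" "N \<in> Poly_Mapping.keys (low k)"
          using keys_mult[of "?L k" "low k"] by (auto split: if_splits)
        then show ?thesis
          using wt_low[OF k(1)] by (fastforce simp: wt)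
      next
        case 2
        then obtain N N' where "M = N + N'" "N \<in> Poly_Mapping.keys (h k)" "N' \<in> Poly_Mapping.keys (x k)"
          using keys_mult[of "h k" "x k"] by auto
        then show ?thesis
          using h[OF k(1), of N] Suc.prems(2)[OF k(1), of N'] by (simp add: wt)
      qed
    qed
    \<comment> \<open>\<open>?A\<close> lives in weight \<open>W\<close> and \<open>?B\<close>
      strictly below, so their sum can vanish only if both do. The top layer is therefore a syzygy
      of the leading monomials.\<close>
    have "M \<notin> Poly_Mapping.keys ?A" for M
    proof
      assume M: "M \<in> Poly_Mapping.keys ?A"
      then have "M \<in> Poly_Mapping.keys ?B"
        using AB[of M] by (simp only: in_keys_iff neg_equal_0_iff_equal not_False_eq_True)
      then show False
        using A[OF M] B by blast
    qed
    then have "?A = 0"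
      by (metis keys_eq_empty ex_in_conv)
    then have "\<exists>t. alternating t \<and> (\<forall>k\<in>K. top k = (\<Sum>j\<in>K. ?L j * t k j))
        \<and> (\<forall>k j. \<forall>M\<in>Poly_Mapping.keys (t k j). wt (M + l k + l j) = W)"
      by (intro koszul_exact_monomials assms(1-3)) (use top in \<open>auto simp: wt\<close>)
    then obtain t where t: "alternating t"
      and top_eq: "\<And>k. k \<in> K \<Longrightarrow> top k = (\<Sum>j\<in>K. ?L j * t k j)"
      and wt_t: "\<And>k j M. M \<in> Poly_Mapping.keys (t k j) \<Longrightarrow> wt M + wt (l k) + wt (l j) = W"
      by (auto simp: wt)
    \<comment> \<open>Subtracting the syzygy of the full generators cancels the top layer. What it
      adds comes from the terms \<open>h j\<close> and has smaller weight, because \<open>t\<close>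
      is homogeneous.\<close>
    define x' where "x' k = x k - (\<Sum>j\<in>K. ?f j * t k j)" for k
    have "(\<Sum>k\<in>K. ?f k * x' k) = (\<Sum>k\<in>K. ?f k * x k) - (\<Sum>k\<in>K. ?f k * (\<Sum>j\<in>K. ?f j * t k j))"
      by (simp only: x'_def right_diff_distrib sum_subtractf)
    also have "\<dots> = 0"
      using Suc.prems(1) sum_alternating_eq_0[OF t] by simp
    finally have 1: "(\<Sum>k\<in>K. ?f k * x' k) = 0" .
    have 2: "wt M + wt (l k) < W" if k: "k \<in> K" and M: "M \<in> Poly_Mapping.keys (x' k)" for k M
    proof -
      have "x' k = low k - (\<Sum>j\<in>K. h j * t k j)"
        unfolding x'_def x top_eq[OF k] by (simp add: distrib_right sum.distrib)
      then consider "M \<in> Poly_Mapping.keys (low k)" | "M \<in> Poly_Mapping.keys (\<Sum>j\<in>K. h j * t k j)"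
        using M keys_diff[of "low k" "\<Sum>j\<in>K. h j * t k j"] by auto
      then show ?thesis
      proof cases
        case 2
        then obtain j where j: "j \<in> K" "M \<in> Poly_Mapping.keys (h j * t k j)"
          by (rule keys_sumE)
        then obtain N N' where "M = N + N'" "N \<in> Poly_Mapping.keys (h j)" "N' \<in> Poly_Mapping.keys (t k j)"
          using keys_mult[of "h j" "t k j"] by auto
        then show ?thesis
          using h[OF j(1), of N] wt_t[of N' k j] by (simp add: wt)
      qed (rule wt_low[OF k])
    qed
    obtain s where s: "alternating s" "\<And>k. k \<in> K \<Longrightarrow> x' k = (\<Sum>j\<in>K. ?f j * s k j)"
      using Suc.IH[OF 1 2] by blast
    have "alternating (\<lambda>k j. t k j + s k j)"
      using t s(1) unfolding alternating_def by (metis add.right_neutral minus_add_distrib)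
    moreover have "x k = (\<Sum>j\<in>K. ?f j * (t k j + s k j))" if "k \<in> K" for k
    proof -
      have "x k = (\<Sum>j\<in>K. ?f j * t k j) + x' k"
        by (simp add: x'_def)
      then show ?thesis
        by (simp only: s(2)[OF that] distrib_left[of "_ + _"] sum.distrib)
    qed
    ultimately show ?case
      by (intro exI[of _ "\<lambda>k j. t k j + s k j"]) blast
  qed
  fix x
  assume "(\<Sum>k\<in>K. ?f k * x k) = 0"
  moreover have "finite (\<Union>k\<in>K. (\<lambda>M. wt M + wt (l k)) ` Poly_Mapping.keys (x k))"
    using assms(1) by simp
  then obtain W where "\<forall>n\<in>(\<Union>k\<in>K. (\<lambda>M. wt M + wt (l k)) ` Poly_Mapping.keys (x k)). n < W"
    using finite_nat_set_iff_bounded by blast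
  then have "wt M + wt (l k) < W" if "k \<in> K" "M \<in> Poly_Mapping.keys (x k)" for k M
    using that by blast
  ultimately show "\<exists>t. alternating t \<and> (\<forall>k\<in>K. x k = (\<Sum>j\<in>K. ?f j * t k j))"
    by (rule lift)
qed

section \<open>Momenta on the mass shells\<close>

lemma sum_UNIV_4: "(\<Sum>\<mu>\<in>UNIV. f (\<mu> :: 4)) = f 0 + f 1 + f 2 + f 3"
proof -
  \<comment> \<open>\<open>sum_4\<close> enumerates the indices as 1, 2, 3, 4, the last being the
    time component 0.\<close>
  have "(4::4) = 0"
    by simp
  then show ?thesis
    unfolding sum_4 by (simp only: ac_simps)
qed

definition eta :: "4 \<Rightarrow> complex" where
  "eta \<mu> = of_real (minkowski \<mu> \<mu>)"

lemma eta_simps [simp]: "eta 0 = 1" "eta 1 = - 1" "eta 2 = - 1" "eta 3 = - 1"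
  by (simp_all add: eta_def minkowski_def)

text \<open>
  The coefficient space of words with \<open>n\<close> letters and prescribed fields: the variable \<open>(i, \<mu>)\<close>
  is the component \<open>\<mu>\<close> of the momentum of the letter at position \<open>i\<close>.
\<close>

type_synonym symbol = "(nat \<times> 4) multiset \<Rightarrow>\<^sub>0 complex"

definition mvar :: "nat \<Rightarrow> 4 \<Rightarrow> symbol" where
  "mvar i \<mu> = Poly_Mapping.single {#(i, \<mu>)#} 1"

definition momentum :: "nat \<Rightarrow> 4 \<Rightarrow> symbol" where
  "momentum n \<mu> = (\<Sum>i<n. mvar i \<mu>)"

text \<open>\<open>M i\<close> is the squared mass; d_mu acts as p_mu without an imaginary unit,
  hence the plus sign.\<close>

definition mass_shell :: "(nat \<Rightarrow> complex) \<Rightarrow> nat \<Rightarrow> symbol" where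
  "mass_shell M i = (\<Sum>\<mu>\<in>UNIV. scalar (eta \<mu>) * (mvar i \<mu>)\<^sup>2) + scalar (M i)"

section \<open>Weight bounds and the reduction of the third mass shell\<close>

definition weight_le :: "('v \<Rightarrow> nat) \<Rightarrow> nat \<Rightarrow> ('v multiset \<Rightarrow>\<^sub>0 complex) \<Rightarrow> bool" where
  "weight_le \<omega> d f \<longleftrightarrow> (\<forall>M\<in>Poly_Mapping.keys f. (\<Sum>v\<in>#M. \<omega> v) \<le> d)"

lemma weight_le_add: "weight_le \<omega> d f \<Longrightarrow> weight_le \<omega> d g \<Longrightarrow> weight_le \<omega> d (f + g)"
  using keys_add[of f g] by (auto simp: weight_le_def)

lemma weight_le_uminus: "weight_le \<omega> d f \<Longrightarrow> weight_le \<omega> d (- f)"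
  by (auto simp: weight_le_def in_keys_iff)

lemma weight_le_diff: "weight_le \<omega> d f \<Longrightarrow> weight_le \<omega> d g \<Longrightarrow> weight_le \<omega> d (f - g)"
  using weight_le_add[OF _ weight_le_uminus] by fastforce

lemma weight_le_mult:
  "weight_le \<omega> a f \<Longrightarrow> weight_le \<omega> b g \<Longrightarrow> a + b \<le> d \<Longrightarrow> weight_le \<omega> d (f * g)"
  using keys_mult[of f g] by (fastforce simp: weight_le_def)

lemma weight_le_power2:
  "weight_le \<omega> a f \<Longrightarrow> 2 * a \<le> d \<Longrightarrow> weight_le \<omega> d (f\<^sup>2)"
  unfolding power2_eq_square by (rule weight_le_mult) auto

lemma weight_le_sum:
  "(\<And>i. i \<in> A \<Longrightarrow> weight_le \<omega> d (f i)) \<Longrightarrow> weight_le \<omega> d (\<Sum>i\<in>A. f i)"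
  by (induction A rule: infinite_finite_induct) (auto simp: weight_le_def[of _ _ 0] intro: weight_le_add)

lemma weight_le_scalar: "weight_le \<omega> d (scalar c)"
  by (auto simp: weight_le_def)

lemma weight_le_mvar: "\<omega> (i, \<mu>) \<le> d \<Longrightarrow> weight_le \<omega> d (mvar i \<mu>)"
  by (auto simp: weight_le_def mvar_def)

text \<open>On vanishing total momentum this is minus the third momentum.\<close>

definition other_momentum :: "nat \<Rightarrow> 4 \<Rightarrow> symbol" where
  "other_momentum n \<mu> = mvar 0 \<mu> + mvar 1 \<mu> + (\<Sum>i\<in>{3..<n}. mvar i \<mu>)"

text \<open>With P the sum of the momenta from position 3 on, this is (p_0 + p_1 + P)^2 - p_0^2 -
  p_1^2 plus masses: the third shell at vanishing total momentum, from which the first two shells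
  are subtracted to remove their squares.\<close>

definition reduced_shell :: "(nat \<Rightarrow> complex) \<Rightarrow> nat \<Rightarrow> symbol" where
  "reduced_shell M n = 2 * (\<Sum>\<mu>\<in>UNIV. scalar (eta \<mu>) * mvar 0 \<mu> * mvar 1 \<mu>)
     + (\<Sum>\<mu>\<in>UNIV. scalar (eta \<mu>) * (2 * (mvar 0 \<mu> + mvar 1 \<mu>) * (\<Sum>i\<in>{3..<n}. mvar i \<mu>)
          + (\<Sum>i\<in>{3..<n}. mvar i \<mu>)\<^sup>2))
     + scalar (M 2 - M 0 - M 1)"

lemma momentum_eq:
  assumes "3 \<le> n"
  shows "momentum n \<mu> = mvar 2 \<mu> + other_momentum n \<mu>"
proof -
  have "{..<n} = {0, 1, 2} \<union> {3..<n}"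
    using assms by auto
  then show ?thesis
    by (simp add: momentum_def other_momentum_def sum.union_disjoint)
qed

text \<open>Writing o for \<open>other_momentum\<close>, p_2 = q - o gives p_2^2 = o^2 + (q - 2 o)
  q; this is the origin of the cofactor of q.\<close>

lemma mass_shell_2_eq:
  assumes "3 \<le> n"
  shows "mass_shell M 2 = reduced_shell M n + mass_shell M 0 + mass_shell M 1
    + (\<Sum>\<mu>\<in>UNIV. scalar (eta \<mu>) * (momentum n \<mu> - 2 * other_momentum n \<mu>) * momentum n \<mu>)"
proof -
  have "(mvar 2 \<mu>)\<^sup>2 = (momentum n \<mu> - 2 * other_momentum n \<mu>) * momentum n \<mu>
      + (mvar 0 \<mu>)\<^sup>2 + (mvar 1 \<mu>)\<^sup>2 + 2 * (mvar 0 \<mu> * mvar 1 \<mu>)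
      + (2 * (mvar 0 \<mu> + mvar 1 \<mu>) * (\<Sum>i\<in>{3..<n}. mvar i \<mu>)
          + (\<Sum>i\<in>{3..<n}. mvar i \<mu>)\<^sup>2)" for \<mu>
    unfolding momentum_eq[OF assms] other_momentum_def
    by (simp add: power2_eq_square algebra_simps)
  then show ?thesis
    unfolding mass_shell_def reduced_shell_def
    by (simp add: distrib_left sum.distrib sum_distrib_left single_diff mult.assoc mult.left_commute)
qed

definition generators :: "(nat \<Rightarrow> complex) \<Rightarrow> nat \<Rightarrow> 4 + nat \<Rightarrow> symbol" where
  "generators M n = case_sum (momentum n) (mass_shell M)"

text \<open>
  Leading monomials for the weight below, which are pairwise coprime once the third mass shell
  has been reduced modulo the other generators. In the reduction the term
  \<open>2 p\<^sub>0 \<bullet> p\<^sub>1\<close> has to be led by a product of components other than the leading ones of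
  \<open>p\<^sub>0\<^sup>2\<close> and \<open>p\<^sub>1\<^sup>2\<close>.
\<close>

definition leading_weight :: "nat \<times> 4 \<Rightarrow> nat" where
  "leading_weight = (\<lambda>(i, \<mu>).
     if i = 2 then 11
     else if i = 0 then if \<mu> = 0 then 10 else if \<mu> = 1 then 1 else if \<mu> = 2 then 9 else 0
     else if i = 1 then if \<mu> = 0 then 1 else if \<mu> = 1 then 10 else if \<mu> = 2 then 9 else 0
     else if \<mu> = 0 then 1 else 0)"

definition leading_monomial :: "4 + nat \<Rightarrow> (nat \<times> 4) multiset" where
  "leading_monomial = case_sum (\<lambda>\<mu>. {#(2, \<mu>)#})
     (\<lambda>i. if i = 1 then {#(1, 1), (1, 1)#} else if i = 2 then {#(0, 2), (1, 2)#}
          else {#(i, 0), (i, 0)#})"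

text \<open>\<open>- 1\<close> is \<open>eta 1\<close>, from the square of p_1, and
  \<open>- 2\<close> is \<open>2 * eta 2\<close>, from 2 p_0 p_1.\<close>

definition leading_coeff :: "4 + nat \<Rightarrow> complex" where
  "leading_coeff = case_sum (\<lambda>\<mu>. 1) (\<lambda>i. if i = 1 then - 1 else if i = 2 then - 2 else 1)"

definition lower_terms :: "(nat \<Rightarrow> complex) \<Rightarrow> nat \<Rightarrow> 4 + nat \<Rightarrow> symbol" where
  "lower_terms M n = case_sum (other_momentum n)
     (\<lambda>i. if i = 1 then (mvar 1 0)\<^sup>2 - (mvar 1 2)\<^sup>2 - (mvar 1 3)\<^sup>2 + scalar (M 1)
          else if i = 2 then
            scalar 2 * (mvar 0 0 * mvar 1 0 - mvar 0 1 * mvar 1 1 - mvar 0 3 * mvar 1 3)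
            + (\<Sum>\<mu>\<in>UNIV. scalar (eta \<mu>) *
                (scalar 2 * (mvar 0 \<mu> + mvar 1 \<mu>) * (\<Sum>i\<in>{3..<n}. mvar i \<mu>)
                  + (\<Sum>i\<in>{3..<n}. mvar i \<mu>)\<^sup>2))
            + scalar (M 2 - M 0 - M 1)
          else - (mvar i 1)\<^sup>2 - (mvar i 2)\<^sup>2 - (mvar i 3)\<^sup>2 + scalar (M i))"

lemma leading_plus_lower:
  assumes "3 \<le> n"
  shows "Poly_Mapping.single (leading_monomial k) (leading_coeff k) + lower_terms M n k
    = (if k = Inr 2 then reduced_shell M n else generators M n k)"
proof (cases k)
  case (Inl \<mu>)
  then show ?thesis
    by (simp add: leading_monomial_def leading_coeff_def lower_terms_def generators_def
        momentum_eq[OF assms] mvar_def)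
next
  case (Inr i)
  have sq: "Poly_Mapping.single {#v, w#} c
      = scalar c * Poly_Mapping.single {#v#} 1 * Poly_Mapping.single {#w#} 1"
    for v w :: "nat \<times> 4" and c :: complex
    by (simp add: mult_single add_mset_commute)
  show ?thesis
    by (auto simp: Inr leading_monomial_def leading_coeff_def lower_terms_def generators_def
        reduced_shell_def mass_shell_def sum_UNIV_4 sq mvar_def[symmetric] single_uminus
        power2_eq_square algebra_simps)
qed

text \<open>The weights are tuned to these gaps: 10 < 11 for the momenta, 9 + 9 < 10 + 10 for the
  first two shells, 10 + 1 < 9 + 9 for the reduced shell, and 0 < 2 for the later ones. Thus 9 must
  be below 10, yet large enough for its double to beat 11.\<close>

lemma weight_lower_terms:
  "\<exists>d. weight_le leading_weight d (lower_terms M n k)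
     \<and> d < (\<Sum>v\<in>#leading_monomial k. leading_weight v)"
proof (cases k)
  case (Inl \<mu>)
  have "weight_le leading_weight 10 (lower_terms M n k)"
    unfolding Inl lower_terms_def other_momentum_def sum.case
    by (intro weight_le_add weight_le_sum weight_le_mvar) (auto simp: leading_weight_def)
  then show ?thesis
    by (intro exI[of _ 10]) (simp add: Inl leading_monomial_def leading_weight_def)
next
  case (Inr i)
  consider "i = 0" | "i = 1" | "i = 2" | "i \<ge> 3"
    by linarith
  then show ?thesis
  proof cases
    case 1
    have "weight_le leading_weight 18 (lower_terms M n k)"
      unfolding Inr 1 lower_terms_def sum.case
      by (auto intro!: weight_le_add weight_le_diff weight_le_uminus weight_le_scalar
          weight_le_power2[OF weight_le_mvar[OF order.refl]] simp: leading_weight_def)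
    then show ?thesis
      by (intro exI[of _ 18]) (simp add: Inr 1 leading_monomial_def leading_weight_def)
  next
    case 2
    have "weight_le leading_weight 18 (lower_terms M n k)"
      unfolding Inr 2 lower_terms_def sum.case
      by (auto intro!: weight_le_add weight_le_diff weight_le_uminus weight_le_scalar
          weight_le_power2[OF weight_le_mvar[OF order.refl]] simp: leading_weight_def)
    then show ?thesis
      by (intro exI[of _ 18]) (simp add: Inr 2 leading_monomial_def leading_weight_def)
  next
    case 3
    have P: "weight_le leading_weight 1 (\<Sum>i\<in>{3..<n}. mvar i \<mu>)" for \<mu>
      by (intro weight_le_sum weight_le_mvar) (auto simp: leading_weight_def)
    have Q: "weight_le leading_weight 10 (mvar 0 \<mu> + mvar 1 \<mu>)" for \<mu>
      by (intro weight_le_add weight_le_mvar) (auto simp: leading_weight_def)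
    have R: "weight_le leading_weight 11 (mvar 0 \<mu> * mvar 1 \<mu>)" if "\<mu> \<noteq> 2" for \<mu>
      using that
      by (intro weight_le_mult[OF weight_le_mvar[OF order.refl] weight_le_mvar[OF order.refl]])
        (auto simp: leading_weight_def)
    have S: "weight_le leading_weight 11 (scalar c * f)" if "weight_le leading_weight 11 f" for c f
      using weight_le_mult[OF weight_le_scalar[of _ 0] that] by simp
    have T: "weight_le leading_weight 11 (f\<^sup>2)" if "weight_le leading_weight 1 f" for f
      using weight_le_power2[OF that] by simp
    have U: "weight_le leading_weight 11 (scalar 2 * (mvar 0 \<mu> + mvar 1 \<mu>) * (\<Sum>i\<in>{3..<n}. mvar i \<mu>))"
      for \<mu>
      unfolding mult.assoc by (intro S weight_le_mult[OF Q P]) simp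
    have eq: "lower_terms M n k =
        scalar 2 * (mvar 0 0 * mvar 1 0 - mvar 0 1 * mvar 1 1 - mvar 0 3 * mvar 1 3)
        + (\<Sum>\<mu>\<in>UNIV. scalar (eta \<mu>) *
            (scalar 2 * (mvar 0 \<mu> + mvar 1 \<mu>) * (\<Sum>i\<in>{3..<n}. mvar i \<mu>)
              + (\<Sum>i\<in>{3..<n}. mvar i \<mu>)\<^sup>2))
        + scalar (M 2 - M 0 - M 1)"
      by (simp add: Inr 3 lower_terms_def)
    have "weight_le leading_weight 11 (lower_terms M n k)"
      unfolding eq
      by (intro S T U P weight_le_add weight_le_diff weight_le_scalar weight_le_sum R) simp_all
    then show ?thesis
      by (intro exI[of _ 11]) (simp add: Inr 3 leading_monomial_def leading_weight_def)
  next
    case 4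
    have "weight_le leading_weight 0 (lower_terms M n k)"
      unfolding Inr lower_terms_def sum.case using 4
      by (auto intro!: weight_le_add weight_le_diff weight_le_uminus weight_le_scalar
          weight_le_power2[OF weight_le_mvar[OF order.refl]] simp: leading_weight_def)
    then show ?thesis
      using 4 by (intro exI[of _ 0]) (simp add: Inr leading_monomial_def leading_weight_def)
  qed
qed

text \<open>The third shell itself would be led by squares of components of p_2, which share
  variables with the leading monomials of the q_mu. Exactness is therefore obtained for the reduced
  shell and carried back by a change of generators.\<close>

lemma koszul_exact_generators:
  assumes n: "3 \<le> n"
  shows "koszul_exact (UNIV <+> {..<n}) (generators M n)"
proof -
  let ?K = "UNIV <+> {..<n} :: (4 + nat) set"
  let ?f = "\<lambda>k. if k = Inr 2 then reduced_shell M n else generators M n k"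
  \<comment> \<open>The cofactors of \<open>mass_shell_2_eq\<close>, with 0 at the third shell
    itself.\<close>
  let ?G = "case_sum (\<lambda>\<mu>. scalar (eta \<mu>) * (momentum n \<mu> - 2 * other_momentum n \<mu>))
    (\<lambda>i. if i \<in> {0, 1} then 1 else 0)"
  have "koszul_exact ?K (\<lambda>k. Poly_Mapping.single (leading_monomial k) (leading_coeff k)
      + lower_terms M n k)"
  proof (rule koszul_exact_coprime_leading[where wt = "\<lambda>M. \<Sum>v\<in>#M. leading_weight v"])
    show "leading_monomial k \<inter># leading_monomial j = {#}" if "k \<noteq> j" for k j
      using that by (auto simp: leading_monomial_def split: sum.splits)
    show "(\<Sum>v\<in>#N. leading_weight v) < (\<Sum>v\<in>#leading_monomial k. leading_weight v)"
      if "N \<in> Poly_Mapping.keys (lower_terms M n k)" for k N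
      using that weight_lower_terms[of M n k] unfolding weight_le_def by fastforce
  qed (auto simp: leading_coeff_def split: sum.splits)
  then have "koszul_exact ?K ?f"
    by (simp only: leading_plus_lower[OF n])
  then have "koszul_exact ?K (\<lambda>k. if k = Inr 2 then ?f (Inr 2) + (\<Sum>b\<in>?K. ?G b * ?f b) else ?f k)"
    by (rule koszul_exact_change_generator) (use n in auto)
  also have "?f (Inr 2) + (\<Sum>b\<in>?K. ?G b * ?f b) = generators M n (Inr 2)"
  proof -
    have "(\<Sum>i<n. (if i \<in> {0, 1} then 1 else 0) * ?f (Inr i))
        = (\<Sum>i\<in>{0, 1}. mass_shell M i)"
      using n by (intro sum.mono_neutral_cong_right) (auto simp: generators_def)
    then show ?thesis
      by (simp add: sum.Plus mass_shell_2_eq[OF n] generators_def)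
  qed
  finally show ?thesis
    by (rule arg_cong[where f = "koszul_exact ?K", THEN iffD1, rotated]) auto
qed

text \<open>\<open>s\<close> and \<open>- g\<close> together form a syzygy of all generators. In its
  alternating matrix the block between momenta is the potential, and the block between momenta and
  shells is the part that vanishes on shell.\<close>

lemma momentum_syzygy:
  assumes "3 \<le> n" and "(\<Sum>\<mu>\<in>UNIV. momentum n \<mu> * s \<mu>) = (\<Sum>i<n. mass_shell M i * g i)"
  shows "\<exists>t h. (\<forall>\<mu> \<nu>. t \<mu> \<nu> = - t \<nu> \<mu>) \<and>
    (\<forall>\<mu>. s \<mu> = (\<Sum>\<nu>\<in>UNIV. momentum n \<nu> * t \<mu> \<nu>) + (\<Sum>i<n. mass_shell M i * h \<mu> i))"
proof -
  let ?K = "UNIV <+> {..<n} :: (4 + nat) set"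
  have "(\<Sum>k\<in>?K. generators M n k * case_sum s (\<lambda>i. - g i) k) = 0"
    by (simp add: sum.Plus generators_def assms(2) sum_negf)
  then obtain t where t: "alternating t"
    and s: "\<forall>k\<in>?K. case_sum s (\<lambda>i. - g i) k = (\<Sum>j\<in>?K. generators M n j * t k j)"
    using koszul_exact_generators[OF assms(1), unfolded koszul_exact_def] by blast
  show ?thesis
  proof (intro exI conjI allI)
    show "t (Inl \<mu>) (Inl \<nu>) = - t (Inl \<nu>) (Inl \<mu>)" for \<mu> \<nu>
      using t unfolding alternating_def by blast
    show "s \<mu> = (\<Sum>\<nu>\<in>UNIV. momentum n \<nu> * t (Inl \<mu>) (Inl \<nu>))
        + (\<Sum>i<n. mass_shell M i * t (Inl \<mu>) (Inr i))" for \<mu>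
      using bspec[OF s, OF InlI[OF UNIV_I], of \<mu>] by (simp add: sum.Plus generators_def)
  qed
qed

section \<open>Words and symbols\<close>

lemma shift_commute: "shift \<mu> (shift \<nu> v) = shift \<nu> (shift \<mu> v)"
  by (simp add: shift_def add_mset_commute)

lemma fst_shift [simp]: "fst (shift \<mu> v) = fst v"
  by (simp add: shift_def)

definition klein_gordon :: "('f \<Rightarrow> real) \<Rightarrow> 'f jet \<Rightarrow> 'f expr" where
  "klein_gordon m v = (\<Sum>\<mu>\<in>UNIV. scalar (eta \<mu>) * var (shift \<mu> (shift \<mu> v)))
     + scalar (of_real ((m (fst v))\<^sup>2)) * var v"

lemma total_deriv_klein_gordon: "total_deriv \<mu> (klein_gordon m v) = klein_gordon m (shift \<mu> v)"
  by (simp add: klein_gordon_def total_deriv_sum shift_commute[of \<mu>])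

lemma klein_gordon_basic:
  "(\<Sum>\<mu>\<in>UNIV. \<Sum>\<nu>\<in>UNIV.
      const (of_real (minkowski \<mu> \<nu>)) * total_deriv \<mu> (total_deriv \<nu> (basic_field \<alpha>)))
    + const (of_real ((m \<alpha>)\<^sup>2)) * basic_field \<alpha> = klein_gordon m (\<alpha>, {#})"
proof -
  have "(\<Sum>\<nu>\<in>UNIV. const (of_real (minkowski \<mu> \<nu>)) * total_deriv \<mu> (total_deriv \<nu> (basic_field \<alpha>)))
      = scalar (eta \<mu>) * var (shift \<mu> (shift \<mu> (\<alpha>, {#})))" for \<mu>
  proof -
    have "(\<Sum>\<nu>\<in>UNIV. const (of_real (minkowski \<mu> \<nu>)) * total_deriv \<mu> (total_deriv \<nu> (basic_field \<alpha>)))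
        = (\<Sum>\<nu>\<in>{\<mu>}. const (of_real (minkowski \<mu> \<nu>)) * total_deriv \<mu> (total_deriv \<nu> (basic_field \<alpha>)))"
      by (rule sum.mono_neutral_right) (auto simp: minkowski_def const_eq_scalar)
    then show ?thesis
      by (simp add: const_eq_scalar eta_def basic_field_def)
  qed
  then show ?thesis
    by (simp add: klein_gordon_def const_eq_scalar basic_field_def)
qed

text \<open>Differentiating a free equation only appends an index to its jet variable, so every
  derived equation is a Klein-Gordon expression at some jet.\<close>

lemma free_equations_eq: "free_equations m = range (klein_gordon m)"
proof (intro equalityI subsetI)
  fix f assume "f \<in> free_equations m"
  then show "f \<in> range (klein_gordon m)"
  proof induction
    case (equation \<alpha>)
    show ?case
      unfolding klein_gordon_basic by (rule rangeI)
  qed (auto simp: total_deriv_klein_gordon)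
next
  have "klein_gordon m (\<alpha>, N) \<in> free_equations m" for \<alpha> N
  proof (induction N)
    case empty
    show ?case
      using free_equations.equation[where m = m and \<alpha> = \<alpha>] by (simp only: klein_gordon_basic)
  next
    case (add \<mu> N)
    then show ?case
      using free_equations.derivative[OF add, of \<mu>]
      by (simp add: total_deriv_klein_gordon shift_def)
  qed
  then show "f \<in> range (klein_gordon m) \<Longrightarrow> f \<in> free_equations m" for f
    by auto
qed

section \<open>Dictionary between words with prescribed fields and polynomials in the
  momenta\<close>

definition word_symbol :: "'f jet list \<Rightarrow> (nat \<times> 4) multiset" where
  "word_symbol w = (\<Sum>i<length w. image_mset (Pair i) (snd (w ! i)))"

text \<open>Variables at positions beyond the list of fields are discarded; the later rules for
  multiplication by a momentum component therefore require
  \<open>i < length \<alpha>s\<close>.\<close>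

definition symbol_word :: "'f list \<Rightarrow> (nat \<times> 4) multiset \<Rightarrow> 'f jet list" where
  "symbol_word \<alpha>s M =
     map (\<lambda>i. (\<alpha>s ! i, image_mset snd (filter_mset (\<lambda>p. fst p = i) M))) [0..<length \<alpha>s]"

text \<open>Words with other fields go to 0, so that following it by \<open>of_symbol\<close>
  projects onto one component of the free algebra.\<close>

definition to_symbol :: "'f list \<Rightarrow> 'f expr \<Rightarrow> symbol" where
  "to_symbol \<alpha>s =
     lin_ext (\<lambda>w. if map fst w = \<alpha>s then Poly_Mapping.single (word_symbol w) 1 else 0)"

definition of_symbol :: "'f list \<Rightarrow> symbol \<Rightarrow> 'f expr" where
  "of_symbol \<alpha>s = lin_ext (\<lambda>M. Poly_Mapping.single (symbol_word \<alpha>s M) 1)"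

lemma length_symbol_word [simp]: "length (symbol_word \<alpha>s M) = length \<alpha>s"
  by (simp add: symbol_word_def)

lemma fst_symbol_word: "i < length \<alpha>s \<Longrightarrow> fst (symbol_word \<alpha>s M ! i) = \<alpha>s ! i"
  by (simp add: symbol_word_def)

lemma word_symbol_update:
  assumes "i < length w"
  shows "word_symbol (w[i := shift \<mu> (w ! i)]) = add_mset (i, \<mu>) (word_symbol w)"
proof -
  have "word_symbol (w[i := shift \<mu> (w ! i)])
      = image_mset (Pair i) (snd (shift \<mu> (w ! i)))
        + (\<Sum>j\<in>{..<length w} - {i}. image_mset (Pair j) (snd (w ! j)))"
    using assms by (simp add: word_symbol_def sum.remove[of _ i])
  also have "\<dots> = add_mset (i, \<mu>) (word_symbol w)"
    using assms by (simp add: word_symbol_def sum.remove[of "{..<length w}" i] shift_def)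
  finally show ?thesis .
qed

lemma symbol_word_add_mset:
  assumes "i < length \<alpha>s"
  shows "symbol_word \<alpha>s (add_mset (i, \<mu>) M)
    = (symbol_word \<alpha>s M)[i := shift \<mu> (symbol_word \<alpha>s M ! i)]"
  by (rule nth_equalityI)
    (use assms in \<open>auto simp: symbol_word_def nth_list_update shift_def\<close>)

lemma symbol_word_word_symbol: "symbol_word (map fst w) (word_symbol w) = w"
proof -
  have filter: "filter_mset (\<lambda>p. fst p = i) (\<Sum>j\<in>A. image_mset (Pair j) (g j))
      = (if i \<in> A then image_mset (Pair i) (g i) else {#})"
    if "finite A" for i :: nat and A and g :: "nat \<Rightarrow> 4 multiset"
    using that by (induction A rule: finite_induct) (auto simp: filter_mset_image_mset)
  show ?thesis
    by (rule nth_equalityI)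
      (auto simp: symbol_word_def word_symbol_def filter multiset.map_comp comp_def)
qed

lemma mvar_mult_single: "mvar i \<mu> * Poly_Mapping.single M c = Poly_Mapping.single (add_mset (i, \<mu>) M) c"
  by (simp add: mvar_def mult_single)

lemma map_fst_update_shift: "map fst (w[i := shift \<mu> (w ! i)]) = map fst w"
  by (simp add: map_update) (metis list_update_beyond list_update_id map_update not_le nth_map)

text \<open>The Leibniz term at position i appends an index to that letter, which is multiplication
  by p_i; the fields, and hence the component, do not change.\<close>

lemma to_symbol_total_deriv:
  "to_symbol \<alpha>s (total_deriv \<mu> f) = momentum (length \<alpha>s) \<mu> * to_symbol \<alpha>s f"
proof (induction f rule: poly_mapping_single_induct)
  case (single w c)
  have "to_symbol \<alpha>s (deriv_word \<mu> w) = momentum (length \<alpha>s) \<mu> * to_symbol \<alpha>s (Poly_Mapping.single w 1)"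
  proof (cases "map fst w = \<alpha>s")
    case True
    have len: "length w = length \<alpha>s"
      using True by auto
    have "to_symbol \<alpha>s (deriv_word \<mu> w)
        = (\<Sum>i<length w. Poly_Mapping.single (word_symbol (w[i := shift \<mu> (w ! i)])) 1)"
      by (simp add: to_symbol_def deriv_word_def lin_ext_sum map_fst_update_shift True)
    also have "\<dots> = (\<Sum>i<length w. mvar i \<mu> * Poly_Mapping.single (word_symbol w) 1)"
      by (simp add: word_symbol_update mvar_mult_single)
    also have "\<dots> = momentum (length \<alpha>s) \<mu> * to_symbol \<alpha>s (Poly_Mapping.single w 1)"
      by (simp add: momentum_def sum_distrib_right to_symbol_def True len)
    finally show ?thesis .
  next
    case False
    then show ?thesis
      by (simp add: to_symbol_def deriv_word_def lin_ext_sum map_fst_update_shift)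
  qed
  then show ?case
    by (simp add: total_deriv_eq_lin_ext to_symbol_def mult.left_commute)
qed (simp_all add: to_symbol_def distrib_left)

abbreviation squared_masses :: "('f \<Rightarrow> real) \<Rightarrow> 'f list \<Rightarrow> nat \<Rightarrow> complex" where
  "squared_masses m \<alpha>s i \<equiv> of_real ((m (\<alpha>s ! i))\<^sup>2)"

lemma klein_gordon_in_word:
  "Poly_Mapping.single u 1 * (klein_gordon m v * Poly_Mapping.single w 1)
    = (\<Sum>\<mu>\<in>UNIV. scalar (eta \<mu>) * Poly_Mapping.single (u @ shift \<mu> (shift \<mu> v) # w) 1)
      + scalar (of_real ((m (fst v))\<^sup>2)) * Poly_Mapping.single (u @ v # w) 1"
proof -
  have "Poly_Mapping.single u 1 * (scalar c * x * Poly_Mapping.single w 1)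
      = scalar c * (Poly_Mapping.single u 1 * (x * Poly_Mapping.single w 1))" for c :: complex and x
    by (simp only: mult.assoc scalar_left_commute)
  then show ?thesis
    by (simp add: klein_gordon_def distrib_left distrib_right sum_distrib_left sum_distrib_right
        single_append single_Cons)
qed

text \<open>A free equation between the words \<open>u\<close> and \<open>w\<close> becomes the mass
  shell at position \<open>length u\<close> times the monomial of the whole word, provided the
  fields match.\<close>

lemma to_symbol_free_ideal:
  assumes "f \<in> two_sided_ideal (free_equations m)"
  shows "\<exists>g. to_symbol \<alpha>s f = (\<Sum>i<length \<alpha>s. mass_shell (squared_masses m \<alpha>s) i * g i)"
  using assms
proof (induction rule: two_sided_ideal_word_induct)
  case zero
  show ?case
    by (rule exI[of _ "\<lambda>_. 0"]) (simp add: to_symbol_def)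
next
  case (add f g)
  then obtain a b where
    "to_symbol \<alpha>s f = (\<Sum>i<length \<alpha>s. mass_shell (squared_masses m \<alpha>s) i * a i)"
    "to_symbol \<alpha>s g = (\<Sum>i<length \<alpha>s. mass_shell (squared_masses m \<alpha>s) i * b i)"
    by blast
  then show ?case
    by (intro exI[of _ "\<lambda>i. a i + b i"]) (simp add: to_symbol_def distrib_left sum.distrib)
next
  case (generator r u c w)
  then obtain v where r: "r = klein_gordon m v"
    by (auto simp: free_equations_eq)
  let ?z = "u @ v # w" and ?i = "length u"
  let ?f = "Poly_Mapping.single u 1 * (klein_gordon m v * Poly_Mapping.single w 1)"
  show ?case
  proof (cases "map fst ?z = \<alpha>s")
    case True
    have len: "length ?z = length \<alpha>s"
      using True by (metis length_map)
    have "word_symbol (u @ shift \<mu> (shift \<mu> v) # w) = add_mset (?i, \<mu>) (add_mset (?i, \<mu>) (word_symbol ?z))" for \<mu>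
      using word_symbol_update[of ?i ?z \<mu>] word_symbol_update[of ?i "u @ shift \<mu> v # w" \<mu>] by simp
    moreover have "\<alpha>s ! ?i = fst v"
      using True by (auto simp: nth_append)
    ultimately have "to_symbol \<alpha>s ?f
        = mass_shell (squared_masses m \<alpha>s) ?i * Poly_Mapping.single (word_symbol ?z) 1"
      using True unfolding klein_gordon_in_word
      by (simp add: to_symbol_def lin_ext_sum mass_shell_def distrib_right sum_distrib_right
          power2_eq_square mult.assoc mvar_mult_single)
    then have "to_symbol \<alpha>s (scalar c * ?f)
        = mass_shell (squared_masses m \<alpha>s) ?i * (scalar c * Poly_Mapping.single (word_symbol ?z) 1)"
      by (simp add: to_symbol_def mult.left_commute)
    also have "\<dots> = (\<Sum>i<length \<alpha>s. mass_shell (squared_masses m \<alpha>s) i *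
        (if i = ?i then scalar c * Poly_Mapping.single (word_symbol ?z) 1 else 0))"
      using len by (simp add: if_distrib cong: if_cong)
    finally show ?thesis
      unfolding r
      by (intro exI[of _ "\<lambda>i. if i = ?i then scalar c * Poly_Mapping.single (word_symbol ?z) 1 else 0"])
  next
    case False
    then have "to_symbol \<alpha>s (scalar c * ?f) = 0"
      unfolding klein_gordon_in_word by (simp add: to_symbol_def lin_ext_sum)
    then show ?thesis
      unfolding r by (intro exI[of _ "\<lambda>_. 0"]) simp
  qed
qed

lemma of_symbol_mvar_mult:
  "i < length \<alpha>s \<Longrightarrow> of_symbol \<alpha>s (mvar i \<mu> * Poly_Mapping.single M c)
    = scalar c * Poly_Mapping.single ((symbol_word \<alpha>s M)[i := shift \<mu> (symbol_word \<alpha>s M ! i)]) 1"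
  by (simp add: of_symbol_def mvar_mult_single symbol_word_add_mset)

lemma of_symbol_momentum_mult:
  "of_symbol \<alpha>s (momentum (length \<alpha>s) \<mu> * f) = total_deriv \<mu> (of_symbol \<alpha>s f)"
proof (induction f rule: poly_mapping_single_induct)
  case (single M c)
  have "of_symbol \<alpha>s (momentum (length \<alpha>s) \<mu> * Poly_Mapping.single M c)
      = (\<Sum>i<length \<alpha>s. of_symbol \<alpha>s (mvar i \<mu> * Poly_Mapping.single M c))"
    by (simp add: momentum_def sum_distrib_right of_symbol_def lin_ext_sum)
  also have "\<dots> = scalar c * deriv_word \<mu> (symbol_word \<alpha>s M)"
    by (simp add: of_symbol_mvar_mult deriv_word_def sum_distrib_left)
  finally show ?case
    by (simp add: of_symbol_def total_deriv_eq_lin_ext)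
qed (simp_all add: of_symbol_def distrib_left)

text \<open>Multiplication by the shell at position i replaces that letter by its free equation; the
  rest of the word supplies the left and right cofactors.\<close>

lemma of_symbol_mass_shell_mult:
  assumes i: "i < length \<alpha>s"
  shows "of_symbol \<alpha>s (mass_shell (squared_masses m \<alpha>s) i * f) \<in> two_sided_ideal (free_equations m)"
proof (induction f rule: poly_mapping_single_induct)
  case (single M c)
  let ?w = "symbol_word \<alpha>s M"
  let ?v = "?w ! i"
  have upd: "?w[i := x] = take i ?w @ x # drop (Suc i) ?w" for x
    using i by (simp add: upd_conv_take_nth_drop)
  have sq: "of_symbol \<alpha>s (scalar (eta \<mu>) * (mvar i \<mu>)\<^sup>2 * Poly_Mapping.single M c)
      = scalar c * (scalar (eta \<mu>) * Poly_Mapping.single (?w[i := shift \<mu> (shift \<mu> ?v)]) 1)" for \<mu>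
    using i by (simp add: power2_eq_square mult.assoc mvar_mult_single of_symbol_def
        symbol_word_add_mset mult_single mult.commute[of c])
  have w: "?w = take i ?w @ ?v # drop (Suc i) ?w"
    using i by (simp add: id_take_nth_drop)
  have "of_symbol \<alpha>s (mass_shell (squared_masses m \<alpha>s) i * Poly_Mapping.single M c)
      = (\<Sum>\<mu>\<in>UNIV. of_symbol \<alpha>s (scalar (eta \<mu>) * (mvar i \<mu>)\<^sup>2 * Poly_Mapping.single M c))
        + scalar c * (scalar (squared_masses m \<alpha>s i) * Poly_Mapping.single ?w 1)"
    by (simp add: mass_shell_def distrib_right sum_distrib_right of_symbol_def lin_ext_sum mult_single
        mult.commute[of c])
  also have "\<dots> = scalar c * ((\<Sum>\<mu>\<in>UNIV. scalar (eta \<mu>) *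
        Poly_Mapping.single (take i ?w @ shift \<mu> (shift \<mu> ?v) # drop (Suc i) ?w) 1)
      + scalar (of_real ((m (fst ?v))\<^sup>2)) * Poly_Mapping.single (take i ?w @ ?v # drop (Suc i) ?w) 1)"
    unfolding sq upd w[symmetric] fst_symbol_word[OF i] by (simp add: sum_distrib_left distrib_left)
  also have "\<dots> = scalar c * Poly_Mapping.single (take i ?w) 1
      * klein_gordon m ?v * Poly_Mapping.single (drop (Suc i) ?w) 1"
    by (simp only: klein_gordon_in_word[symmetric] mult.assoc)
  finally show ?case
    by (simp add: two_sided_ideal.generator free_equations_eq)
qed (auto simp: of_symbol_def distrib_left intro: two_sided_ideal.add)

lemma of_symbol_to_symbol:
  "of_symbol \<alpha>s (to_symbol \<alpha>s f)
    = lin_ext (\<lambda>w. if map fst w = \<alpha>s then Poly_Mapping.single w 1 else 0) f"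
  unfolding of_symbol_def to_symbol_def lin_ext_lin_ext
  by (rule lin_ext_cong) (auto simp: symbol_word_word_symbol)

lemma component_exact:
  assumes "3 \<le> length \<alpha>s"
    and "(\<Sum>\<mu>\<in>UNIV. total_deriv \<mu> (f \<mu>)) \<in> two_sided_ideal (free_equations m)"
  shows "\<exists>T. (\<forall>\<mu> \<nu>. T \<mu> \<nu> = - T \<nu> \<mu>) \<and>
    (\<forall>\<mu>. of_symbol \<alpha>s (to_symbol \<alpha>s (f \<mu>)) - (\<Sum>\<nu>\<in>UNIV. total_deriv \<nu> (T \<mu> \<nu>))
       \<in> two_sided_ideal (free_equations m))"
proof -
  let ?M = "squared_masses m \<alpha>s" and ?n = "length \<alpha>s"
  obtain g where "to_symbol \<alpha>s (\<Sum>\<mu>\<in>UNIV. total_deriv \<mu> (f \<mu>)) = (\<Sum>i<?n. mass_shell ?M i * g i)"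
    using to_symbol_free_ideal[OF assms(2)] by blast
  moreover have "to_symbol \<alpha>s (\<Sum>\<mu>\<in>UNIV. total_deriv \<mu> (f \<mu>))
      = (\<Sum>\<mu>\<in>UNIV. momentum ?n \<mu> * to_symbol \<alpha>s (f \<mu>))"
    by (simp only: to_symbol_total_deriv[symmetric]) (simp only: to_symbol_def lin_ext_sum)
  ultimately have eq: "(\<Sum>\<mu>\<in>UNIV. momentum ?n \<mu> * to_symbol \<alpha>s (f \<mu>)) = (\<Sum>i<?n. mass_shell ?M i * g i)"
    by simp
  obtain t h where t: "\<And>\<mu> \<nu>. t \<mu> \<nu> = - t \<nu> \<mu>"
    and f: "\<And>\<mu>. to_symbol \<alpha>s (f \<mu>) = (\<Sum>\<nu>\<in>UNIV. momentum ?n \<nu> * t \<mu> \<nu>) + (\<Sum>i<?n. mass_shell ?M i * h \<mu> i)"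
    using momentum_syzygy[OF assms(1) eq] by blast
  show ?thesis
  proof (intro exI conjI allI)
    fix \<mu> \<nu>
    show "of_symbol \<alpha>s (t \<mu> \<nu>) = - of_symbol \<alpha>s (t \<nu> \<mu>)"
      by (subst t) (simp add: of_symbol_def)
    have "of_symbol \<alpha>s (to_symbol \<alpha>s (f \<mu>)) - (\<Sum>\<nu>\<in>UNIV. total_deriv \<nu> (of_symbol \<alpha>s (t \<mu> \<nu>)))
        = (\<Sum>i<?n. of_symbol \<alpha>s (mass_shell ?M i * h \<mu> i))"
      by (simp add: f flip: of_symbol_momentum_mult) (simp add: of_symbol_def lin_ext_sum)
    also have "\<dots> \<in> two_sided_ideal (free_equations m)"
      by (intro two_sided_ideal_sum of_symbol_mass_shell_mult) simp
    finally show "of_symbol \<alpha>s (to_symbol \<alpha>s (f \<mu>))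
        - (\<Sum>\<nu>\<in>UNIV. total_deriv \<nu> (of_symbol \<alpha>s (t \<mu> \<nu>))) \<in> two_sided_ideal (free_equations m)" .
  qed
qed

text \<open>The factorials anticipate that the symmetrizer below is not normalized.\<close>

lemma free_exact:
  fixes f :: "4 \<Rightarrow> 'f expr"
  assumes len: "\<And>\<mu>. \<forall>w\<in>Poly_Mapping.keys (f \<mu>). 3 \<le> length w"
    and closed: "(\<Sum>\<mu>\<in>UNIV. total_deriv \<mu> (f \<mu>)) \<in> two_sided_ideal (free_equations m)"
  shows "\<exists>T. (\<forall>\<mu> \<nu>. T \<mu> \<nu> = - T \<nu> \<mu>) \<and>
    (\<forall>\<mu>. lin_ext (\<lambda>w. Poly_Mapping.single w (1 / fact (length w))) (f \<mu>)
         - (\<Sum>\<nu>\<in>UNIV. total_deriv \<nu> (T \<mu> \<nu>)) \<in> two_sided_ideal (free_equations m))"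
proof -
  \<comment> \<open>Only finitely many lists of fields occur, and each is treated on its
    own.\<close>
  define A where "A = (\<Union>\<mu>. map fst ` Poly_Mapping.keys (f \<mu>))"
  have fin: "finite A"
    by (simp add: A_def)
  have "\<forall>\<alpha>s\<in>A. \<exists>T. (\<forall>\<mu> \<nu>. T \<mu> \<nu> = - T \<nu> \<mu>) \<and>
    (\<forall>\<mu>. of_symbol \<alpha>s (to_symbol \<alpha>s (f \<mu>)) - (\<Sum>\<nu>\<in>UNIV. total_deriv \<nu> (T \<mu> \<nu>))
       \<in> two_sided_ideal (free_equations m))"
    by (intro ballI component_exact closed) (use len in \<open>auto simp: A_def\<close>)
  from bchoice[OF this] obtain T where T: "\<forall>\<alpha>s\<in>A. (\<forall>\<mu> \<nu>. T \<alpha>s \<mu> \<nu> = - T \<alpha>s \<nu> \<mu>) \<and>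
    (\<forall>\<mu>. of_symbol \<alpha>s (to_symbol \<alpha>s (f \<mu>)) - (\<Sum>\<nu>\<in>UNIV. total_deriv \<nu> (T \<alpha>s \<mu> \<nu>))
       \<in> two_sided_ideal (free_equations m))" ..
  have anti: "T \<alpha>s \<mu> \<nu> = - T \<alpha>s \<nu> \<mu>" if "\<alpha>s \<in> A" for \<alpha>s \<mu> \<nu>
    using bspec[OF T that] by blast
  have exact: "of_symbol \<alpha>s (to_symbol \<alpha>s (f \<mu>)) - (\<Sum>\<nu>\<in>UNIV. total_deriv \<nu> (T \<alpha>s \<mu> \<nu>))
       \<in> two_sided_ideal (free_equations m)" if "\<alpha>s \<in> A" for \<alpha>s \<mu>
    using bspec[OF T that] by blast
  \<comment> \<open>Words with the same fields have the same length, so the normalization is a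
    constant on each component and commutes with d_nu.\<close>
  let ?c = "\<lambda>\<alpha>s. scalar (1 / fact (length \<alpha>s)) :: 'f expr"
  show ?thesis
  proof (intro exI conjI allI)
    fix \<mu> \<nu>
    show "(\<Sum>\<alpha>s\<in>A. ?c \<alpha>s * T \<alpha>s \<mu> \<nu>) = - (\<Sum>\<alpha>s\<in>A. ?c \<alpha>s * T \<alpha>s \<nu> \<mu>)"
      unfolding sum_negf[symmetric] by (intro sum.cong refl, subst anti) simp_all
    have "(\<Sum>\<alpha>s\<in>A. ?c \<alpha>s * of_symbol \<alpha>s (to_symbol \<alpha>s (f \<mu>)))
        = lin_ext (\<lambda>w. \<Sum>\<alpha>s\<in>A. ?c \<alpha>s * (if map fst w = \<alpha>s then Poly_Mapping.single w 1 else 0)) (f \<mu>)"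
      by (simp only: lin_ext_sum_family lin_ext_scalar_family of_symbol_to_symbol)
    also have "\<dots> = lin_ext (\<lambda>w. Poly_Mapping.single w (1 / fact (length w))) (f \<mu>)"
    proof (rule lin_ext_cong)
      fix w assume "w \<in> Poly_Mapping.keys (f \<mu>)"
      then have "map fst w \<in> A"
        by (auto simp: A_def)
      then have "(\<Sum>\<alpha>s\<in>A. ?c \<alpha>s * (if map fst w = \<alpha>s then Poly_Mapping.single w 1 else 0))
          = ?c (map fst w) * Poly_Mapping.single w 1"
        using fin by (simp add: if_distrib cong: if_cong)
      then show "(\<Sum>\<alpha>s\<in>A. ?c \<alpha>s * (if map fst w = \<alpha>s then Poly_Mapping.single w 1 else 0))
          = Poly_Mapping.single w (1 / fact (length w))"
        by (simp add: mult_single)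
    qed
    finally have eq: "lin_ext (\<lambda>w. Poly_Mapping.single w (1 / fact (length w))) (f \<mu>)
        = (\<Sum>\<alpha>s\<in>A. ?c \<alpha>s * of_symbol \<alpha>s (to_symbol \<alpha>s (f \<mu>)))" ..
    have "(\<Sum>\<nu>\<in>UNIV. total_deriv \<nu> (\<Sum>\<alpha>s\<in>A. ?c \<alpha>s * T \<alpha>s \<mu> \<nu>))
        = (\<Sum>\<alpha>s\<in>A. ?c \<alpha>s * (\<Sum>\<nu>\<in>UNIV. total_deriv \<nu> (T \<alpha>s \<mu> \<nu>)))"
      by (simp add: total_deriv_sum sum_distrib_left sum.swap[of _ A])
    then have "lin_ext (\<lambda>w. Poly_Mapping.single w (1 / fact (length w))) (f \<mu>)
        - (\<Sum>\<nu>\<in>UNIV. total_deriv \<nu> (\<Sum>\<alpha>s\<in>A. ?c \<alpha>s * T \<alpha>s \<mu> \<nu>))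
      = (\<Sum>\<alpha>s\<in>A. ?c \<alpha>s * (of_symbol \<alpha>s (to_symbol \<alpha>s (f \<mu>))
          - (\<Sum>\<nu>\<in>UNIV. total_deriv \<nu> (T \<alpha>s \<mu> \<nu>))))"
      by (simp add: eq right_diff_distrib sum_subtractf)
    also have "\<dots> \<in> two_sided_ideal (free_equations m)"
      by (intro two_sided_ideal_sum two_sided_ideal_mult_left exact)
    finally show "lin_ext (\<lambda>w. Poly_Mapping.single w (1 / fact (length w))) (f \<mu>)
        - (\<Sum>\<nu>\<in>UNIV. total_deriv \<nu> (\<Sum>\<alpha>s\<in>A. ?c \<alpha>s * T \<alpha>s \<mu> \<nu>))
      \<in> two_sided_ideal (free_equations m)" .
  qed
qed

section \<open>Graded symmetrization\<close>

abbreviation onshell_ideal :: "('f \<Rightarrow> bool) \<Rightarrow> ('f \<Rightarrow> real) \<Rightarrow> 'f expr set" where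
  "onshell_ideal gr m \<equiv> two_sided_ideal ({graded_commutator gr u v | u v. True} \<union> free_equations m)"

lemma graded_commutator_onshell: "graded_commutator gr u v \<in> onshell_ideal gr m"
  by (rule two_sided_ideal_base, rule UnI1, blast)

lemma klein_gordon_free_ideal: "klein_gordon m v \<in> two_sided_ideal (free_equations m)"
  by (rule two_sided_ideal_base) (simp add: free_equations_eq)

definition koszul_sign :: "('f \<Rightarrow> bool) \<Rightarrow> 'f jet \<Rightarrow> 'f jet \<Rightarrow> complex" where
  "koszul_sign gr u v = (if gr (fst u) \<and> gr (fst v) then - 1 else 1)"

lemma koszul_sign_shift [simp]:
  "koszul_sign gr (shift \<mu> u) v = koszul_sign gr u v"
  "koszul_sign gr u (shift \<mu> v) = koszul_sign gr u v"
  by (simp_all add: koszul_sign_def)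

lemma graded_commutator_eq:
  "graded_commutator gr u v = var u * var v - scalar (koszul_sign gr u v) * (var v * var u)"
  by (simp add: graded_commutator_def koszul_sign_def single_uminus)

text \<open>The sign is the one acquired by moving \<open>v\<close> past the letters to its
  left.\<close>

fun insert_word :: "('f \<Rightarrow> bool) \<Rightarrow> 'f jet \<Rightarrow> 'f jet list \<Rightarrow> 'f expr" where
  "insert_word gr v [] = var v"
| "insert_word gr v (u # w) = Poly_Mapping.single (v # u # w) 1
     + scalar (koszul_sign gr v u) * (var u * insert_word gr v w)"

definition ins :: "('f \<Rightarrow> bool) \<Rightarrow> 'f jet \<Rightarrow> 'f expr \<Rightarrow> 'f expr" where
  "ins gr v = lin_ext (insert_word gr v)"

text \<open>
  The sum over all permutations with their Koszul signs, built by inserting one letter after the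
  other.
\<close>

fun sym_word :: "('f \<Rightarrow> bool) \<Rightarrow> 'f jet list \<Rightarrow> 'f expr" where
  "sym_word gr [] = 1"
| "sym_word gr (v # w) = ins gr v (sym_word gr w)"

definition symmetrize :: "('f \<Rightarrow> bool) \<Rightarrow> 'f expr \<Rightarrow> 'f expr" where
  "symmetrize gr = lin_ext (sym_word gr)"

lemma ins_linear [simp]:
  "ins gr v (f + g) = ins gr v f + ins gr v g"
  "ins gr v (f - g) = ins gr v f - ins gr v g"
  "ins gr v (scalar c * f) = scalar c * ins gr v f"
  "ins gr v 0 = 0"
  by (simp_all add: ins_def)

lemma ins_scalar [simp]: "ins gr v (scalar c) = scalar c * var v"
  by (simp add: ins_def flip: single_Nil)

lemma ins_one [simp]: "ins gr v 1 = var v"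
  using ins_scalar[of gr v 1] by simp

lemma ins_sum: "ins gr v (\<Sum>i\<in>A. f i) = (\<Sum>i\<in>A. ins gr v (f i))"
  by (simp add: ins_def lin_ext_sum)

lemma ins_var [simp]:
  "ins gr v (var u * f) = var v * (var u * f) + scalar (koszul_sign gr v u) * (var u * ins gr v f)"
proof (induction f rule: poly_mapping_single_induct)
  case (single w c)
  have "scalar c * (scalar s * (x * y)) = scalar s * (x * (scalar c * y))" for s :: complex and x y :: "'a expr"
    by (simp only: scalar_left_commute[of _ c])
  moreover have "scalar c * Poly_Mapping.single (v # u # w) 1 = var v * (var u * Poly_Mapping.single w c)"
    by (simp add: mult_single var_mult_single)
  ultimately show ?case
    by (simp add: ins_def var_mult_single distrib_left)
qed (simp_all add: distrib_left algebra_simps)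

lemma ins_shift: "total_deriv \<mu> (ins gr v f) = ins gr (shift \<mu> v) f + ins gr v (total_deriv \<mu> f)"
  by (induction f rule: expr_word_induct)
    (simp_all add: total_deriv_mult distrib_left algebra_simps)

text \<open>Both orders of insertion reach the same words, and the relative sign is that of
  exchanging \<open>u\<close> and \<open>v\<close>. This is what makes symmetrization annihilate
  graded commutators.\<close>

lemma ins_ins: "ins gr u (ins gr v f) = scalar (koszul_sign gr u v) * ins gr v (ins gr u f)"
proof (induction f rule: expr_word_induct)
  case (scalar c)
  have "ins gr a (var b) = var a * var b + scalar (koszul_sign gr a b) * (var b * var a)" for a b
    using ins_var[of gr a b 1] by simp
  then show ?case
    by (auto simp: koszul_sign_def single_uminus algebra_simps)
next
  case (var x f)
  then show ?case
    by (auto simp: koszul_sign_def single_uminus algebra_simps)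
qed (simp add: distrib_left)

lemma sym_word_zero: "sym_word gr 0 = 1"
  by (simp add: zero_list_def)

lemma symmetrize_linear [simp]:
  "symmetrize gr (f + g) = symmetrize gr f + symmetrize gr g"
  "symmetrize gr (f - g) = symmetrize gr f - symmetrize gr g"
  "symmetrize gr (scalar c * f) = scalar c * symmetrize gr f"
  "symmetrize gr (scalar c) = scalar c"
  "symmetrize gr 0 = 0"
  by (simp_all add: symmetrize_def sym_word_zero)

lemma symmetrize_sum: "symmetrize gr (\<Sum>i\<in>A. f i) = (\<Sum>i\<in>A. symmetrize gr (f i))"
  by (simp add: symmetrize_def lin_ext_sum)

lemma symmetrize_var [simp]: "symmetrize gr (var v * f) = ins gr v (symmetrize gr f)"
  by (induction f rule: poly_mapping_single_induct)
    (simp_all add: var_mult_single distrib_left, simp add: symmetrize_def)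

lemma symmetrize_total_deriv: "symmetrize gr (total_deriv \<mu> f) = total_deriv \<mu> (symmetrize gr f)"
  by (induction f rule: expr_word_induct) (simp_all add: total_deriv_mult ins_shift)

text \<open>All letters of one free equation belong to the same field and acquire the same signs, so
  the equation can be inserted as a whole at every position.\<close>

lemma ins_klein_gordon:
  "(\<Sum>\<mu>\<in>UNIV. scalar (eta \<mu>) * ins gr (shift \<mu> (shift \<mu> v)) f)
     + scalar (of_real ((m (fst v))\<^sup>2)) * ins gr v f \<in> two_sided_ideal (free_equations m)"
  (is "?X f \<in> ?J")
proof (induction f rule: expr_word_induct)
  case (scalar c)
  have "?X (scalar c) = scalar c * klein_gordon m v"
    by (simp add: klein_gordon_def distrib_left sum_distrib_left scalar_left_commute[of _ c])
  then show ?case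
    by (simp only: two_sided_ideal_mult_left klein_gordon_free_ideal)
next
  case (var u f)
  have eq: "?X (var u * f) = klein_gordon m v * (var u * f) + scalar (koszul_sign gr v u) * (var u * ?X f)"
  proof -
    have "scalar (koszul_sign gr v u) * (var u * (scalar c * y))
        = scalar c * (scalar (koszul_sign gr v u) * (var u * y))" for c y
      by (simp only: scalar_left_commute[of _ c])
    then show ?thesis
      by (simp add: klein_gordon_def distrib_left distrib_right sum.distrib sum_distrib_left
          sum_distrib_right mult.assoc)
  qed
  show ?case
    unfolding eq
    by (rule two_sided_ideal.add[OF two_sided_ideal_mult_right[OF klein_gordon_free_ideal]
          two_sided_ideal_mult_left[OF two_sided_ideal_mult_left[OF var]]])
next
  case (add f g)
  have "?X (f + g) = ?X f + ?X g"
    by (simp add: distrib_left sum.distrib)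
  then show ?case
    using add by (simp only: two_sided_ideal.add)
qed

text \<open>For the same reason an inserted letter passes a free equation as if it were a single
  letter.\<close>

lemma ins_klein_gordon_mult:
  "ins gr v (klein_gordon m u * f) = var v * (klein_gordon m u * f)
    + scalar (koszul_sign gr v u) * (klein_gordon m u * ins gr v f)"
proof -
  have "scalar (koszul_sign gr v u) * (scalar c * y) = scalar c * (scalar (koszul_sign gr v u) * y)"
    "var v * (scalar c * y) = scalar c * (var v * y)" for c y
    by (simp_all only: scalar_left_commute[of _ c])
  then show ?thesis
    by (simp add: klein_gordon_def distrib_left distrib_right sum.distrib sum_distrib_left
        sum_distrib_right mult.assoc ins_sum)
qed

lemma ins_free_ideal:
  assumes "f \<in> two_sided_ideal (free_equations m)"
  shows "ins gr v f \<in> two_sided_ideal (free_equations m)"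
  using assms
proof (induction rule: two_sided_ideal_word_induct)
  case (generator r u c w)
  then obtain x where r: "r = klein_gordon m x"
    by (auto simp: free_equations_eq)
  have "ins gr v (Poly_Mapping.single u 1 * (klein_gordon m x * Poly_Mapping.single w 1))
      \<in> two_sided_ideal (free_equations m)"
  proof (induction u)
    case Nil
    show ?case
      by (simp add: single_Nil ins_klein_gordon_mult klein_gordon_free_ideal two_sided_ideal.add
          two_sided_ideal_mult_left two_sided_ideal_mult_right)
  next
    case (Cons a u)
    then show ?case
      by (simp add: single_Cons mult.assoc klein_gordon_free_ideal two_sided_ideal.add
          two_sided_ideal_mult_left two_sided_ideal_mult_right)
  qed
  then show ?case
    by (simp add: r two_sided_ideal_mult_left)
qed (auto intro: two_sided_ideal.intros)

text \<open>The word to the right is symmetrized first. A commutator in front of it gives 0 by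
  \<open>ins_ins\<close>, a free equation stays in the ideal by \<open>ins_klein_gordon\<close>, and
  the letters of the left word preserve the ideal by \<open>ins_free_ideal\<close>.\<close>

lemma symmetrize_onshell:
  assumes "f \<in> onshell_ideal gr m"
  shows "symmetrize gr f \<in> two_sided_ideal (free_equations m)"
  using assms
proof (induction rule: two_sided_ideal_word_induct)
  case (generator r u c w)
  have "symmetrize gr (Poly_Mapping.single u 1 * (r * Poly_Mapping.single w 1))
      \<in> two_sided_ideal (free_equations m)"
  proof (induction u)
    case Nil
    consider a b where "r = graded_commutator gr a b" | a where "r = klein_gordon m a"
      using generator by (auto simp: free_equations_eq)
    then show ?case
    proof cases
      case 1
      have "symmetrize gr (r * Poly_Mapping.single w 1) = 0"
        by (simp add: 1 graded_commutator_eq left_diff_distrib mult.assoc ins_ins[of gr a b])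
      then show ?thesis
        by (simp add: single_Nil two_sided_ideal.zero)
    next
      case 2
      have "symmetrize gr (r * Poly_Mapping.single w 1)
          = (\<Sum>\<mu>\<in>UNIV. scalar (eta \<mu>) *
              ins gr (shift \<mu> (shift \<mu> a)) (symmetrize gr (Poly_Mapping.single w 1)))
            + scalar (of_real ((m (fst a))\<^sup>2)) * ins gr a (symmetrize gr (Poly_Mapping.single w 1))"
        by (simp add: 2 klein_gordon_def distrib_right sum_distrib_right mult.assoc symmetrize_sum)
      then show ?thesis
        by (simp add: single_Nil ins_klein_gordon del: of_real_power)
    qed
  next
    case (Cons a u)
    then show ?case
      by (simp add: single_Cons mult.assoc ins_free_ideal)
  qed
  then show ?case
    by (simp add: two_sided_ideal_mult_left)
qed (auto intro: two_sided_ideal.intros)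

lemma free_ideal_subset_onshell: "two_sided_ideal (free_equations m) \<subseteq> onshell_ideal gr m"
  by (rule two_sided_ideal_mono) simp

text \<open>Derivatives do not change parities, so the derivative of a graded commutator is a sum of
  two graded commutators.\<close>

lemma total_deriv_onshell:
  assumes "f \<in> onshell_ideal gr m"
  shows "total_deriv \<mu> f \<in> onshell_ideal gr m"
  using assms
proof induction
  case (generator r a b)
  have "total_deriv \<mu> r \<in> onshell_ideal gr m"
  proof (cases "r \<in> free_equations m")
    case True
    then show ?thesis
      by (intro two_sided_ideal_base) (auto intro: free_equations.derivative)
  next
    case False
    then obtain u v where r: "r = graded_commutator gr u v"
      using generator by blast
    have "total_deriv \<mu> r = graded_commutator gr (shift \<mu> u) v + graded_commutator gr u (shift \<mu> v)"
      by (simp add: r graded_commutator_eq total_deriv_mult distrib_left)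
    then show ?thesis
      by (simp only: two_sided_ideal.add graded_commutator_onshell)
  qed
  from two_sided_ideal.add[OF two_sided_ideal.add[OF
        two_sided_ideal.generator[OF generator] two_sided_ideal_mult[OF this]]
      two_sided_ideal.generator[OF generator]]
  have "total_deriv \<mu> a * r * b + a * total_deriv \<mu> r * b + a * r * total_deriv \<mu> b
      \<in> onshell_ideal gr m" .
  then show ?case
    by (simp add: total_deriv_mult algebra_simps)
qed (auto intro: two_sided_ideal.intros)

section \<open>The symmetrizer modulo the full ideal\<close>

lemma keys_insert_word: "w' \<in> Poly_Mapping.keys (insert_word gr v w) \<Longrightarrow> length w' = Suc (length w)"
proof (induction w arbitrary: w')
  case Nil
  then show ?case
    by (simp add: var_def)
next
  case (Cons u w)
  let ?r = "scalar (koszul_sign gr v u) * (var u * insert_word gr v w)"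
  from Cons.prems have "w' = v # u # w \<or> w' \<in> Poly_Mapping.keys ?r"
    using keys_add[of "Poly_Mapping.single (v # u # w) 1" ?r] by auto
  moreover have "length w' = Suc (Suc (length w))" if "w' \<in> Poly_Mapping.keys ?r"
  proof -
    have "w' \<in> Poly_Mapping.keys (var u * insert_word gr v w)"
      using that keys_scalar_mult by blast
    then obtain y where "w' = [u] + y" "y \<in> Poly_Mapping.keys (insert_word gr v w)"
      using keys_mult[of "var u" "insert_word gr v w"] by (auto simp: var_def)
    then show ?thesis
      using Cons.IH by (simp add: plus_list_def)
  qed
  ultimately show ?case
    by auto
qed

lemma keys_sym_word: "w' \<in> Poly_Mapping.keys (sym_word gr w) \<Longrightarrow> length w' = length w"
proof (induction w arbitrary: w')
  case Nil
  then show ?case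
    by (simp add: zero_list_def)
next
  case (Cons v w)
  then obtain y where "y \<in> Poly_Mapping.keys (sym_word gr w)"
      "w' \<in> Poly_Mapping.keys (insert_word gr v y)"
    using keys_lin_ext[of "insert_word gr v" "sym_word gr w"] by (auto simp: ins_def)
  then show ?case
    using keys_insert_word Cons.IH by fastforce
qed

lemma of_nat_left_commute: "x * (of_nat n * y) = of_nat n * (x * y)" for x y :: "'a::semiring_1"
  by (simp only: mult.assoc[symmetric] mult_of_nat_commute[of n x])

text \<open>Moving \<open>v\<close> back to the front costs exactly the sign with which it was
  inserted, so all \<open>Suc (length w)\<close> positions contribute the same class.\<close>

lemma insert_word_onshell:
  "insert_word gr v w - of_nat (Suc (length w)) * Poly_Mapping.single (v # w) 1 \<in> onshell_ideal gr m"
proof (induction w)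
  case Nil
  then show ?case
    by (simp add: var_def two_sided_ideal.zero)
next
  case (Cons u w)
  let ?s = "scalar (koszul_sign gr v u) :: 'a expr" and ?k = "of_nat (Suc (length w)) :: 'a expr"
    and ?w = "Poly_Mapping.single w 1 :: 'a expr"
  \<comment> \<open>The induction hypothesis acts behind \<open>u\<close>; exchanging
    \<open>u\<close> and \<open>v\<close> in its main term costs \<open>?k\<close>
    commutators.\<close>
  have "insert_word gr v (u # w) - of_nat (Suc (length (u # w))) * Poly_Mapping.single (v # u # w) 1
      = ?s * (var u * (insert_word gr v w - ?k * Poly_Mapping.single (v # w) 1))
        - ?k * (graded_commutator gr v u * ?w)"
  proof -
    have "of_nat (Suc (length (u # w))) = ?k + 1"
      by simp
    then show ?thesis
      by (simp add: single_Cons graded_commutator_eq distrib_right right_diff_distrib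
          left_diff_distrib mult.assoc of_nat_left_commute[of _ "Suc _"] del: of_nat_Suc)
  qed
  also have "\<dots> \<in> onshell_ideal gr m"
    by (rule two_sided_ideal_diff[OF two_sided_ideal_mult_left[OF two_sided_ideal_mult_left[OF Cons.IH]]
          two_sided_ideal_mult_left[OF two_sided_ideal_mult_right[OF graded_commutator_onshell]]])
  finally show ?case .
qed

lemma ins_onshell:
  assumes "\<And>w. w \<in> Poly_Mapping.keys f \<Longrightarrow> length w = n"
  shows "ins gr v f - of_nat (Suc n) * (var v * f) \<in> onshell_ideal gr m"
proof -
  have "of_nat (Suc n) * (var v * f) = (\<Sum>w\<in>Poly_Mapping.keys f. scalar (Poly_Mapping.lookup f w)
      * (of_nat (Suc (length w)) * Poly_Mapping.single (v # w) 1))"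
  proof -
    have "of_nat (Suc n) * (var v * f) = (\<Sum>w\<in>Poly_Mapping.keys f.
        of_nat (Suc n) * (var v * Poly_Mapping.single w (Poly_Mapping.lookup f w)))"
      using arg_cong[OF poly_mapping_eq_sum_single[of f], of "\<lambda>x. of_nat (Suc n) * (var v * x)"]
      by (simp only: sum_distrib_left)
    also have "\<dots> = (\<Sum>w\<in>Poly_Mapping.keys f. scalar (Poly_Mapping.lookup f w)
      * (of_nat (Suc (length w)) * Poly_Mapping.single (v # w) 1))"
      by (intro sum.cong refl)
        (simp add: assms of_nat_left_commute[of _ "Suc _"] var_mult_single mult_single del: of_nat_Suc)
    finally show ?thesis .
  qed
  then have "ins gr v f - of_nat (Suc n) * (var v * f)
      = (\<Sum>w\<in>Poly_Mapping.keys f. scalar (Poly_Mapping.lookup f w)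
          * (insert_word gr v w - of_nat (Suc (length w)) * Poly_Mapping.single (v # w) 1))"
    by (simp add: ins_def lin_ext_def right_diff_distrib sum_subtractf del: of_nat_Suc)
  also have "\<dots> \<in> onshell_ideal gr m"
    by (intro two_sided_ideal_sum two_sided_ideal_mult_left insert_word_onshell)
  finally show ?thesis .
qed

text \<open>Every signed rearrangement is congruent to the word itself; each insertion contributes
  one factor of the factorial.\<close>

lemma sym_word_onshell:
  "sym_word gr w - of_nat (fact (length w)) * Poly_Mapping.single w 1 \<in> onshell_ideal gr m"
proof (induction w)
  case Nil
  then show ?case
    by (simp add: single_Nil two_sided_ideal.zero)
next
  case (Cons v w)
  let ?n = "of_nat (Suc (length w)) :: 'a expr" and ?f = "of_nat (fact (length w)) :: 'a expr"
  have "(of_nat (fact (length (v # w))) :: 'a expr) = ?n * ?f"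
    by (simp only: length_Cons fact_Suc of_nat_mult of_nat_id)
  then have "sym_word gr (v # w) - of_nat (fact (length (v # w))) * Poly_Mapping.single (v # w) 1
    = (ins gr v (sym_word gr w) - ?n * (var v * sym_word gr w))
      + ?n * (var v * (sym_word gr w - ?f * Poly_Mapping.single w 1))"
    by (simp add: single_Cons right_diff_distrib of_nat_left_commute[of _ "fact _"] mult.assoc
        del: of_nat_Suc of_nat_fact)
  also have "\<dots> \<in> onshell_ideal gr m"
    by (intro two_sided_ideal.add two_sided_ideal_mult_left Cons.IH ins_onshell keys_sym_word)
  finally show ?case .
qed

text \<open>Dividing after symmetrization is legitimate because symmetrization preserves
  length.\<close>

lemma normalized_symmetrize_onshell:
  "lin_ext (\<lambda>w. Poly_Mapping.single w (1 / fact (length w))) (symmetrize gr f) - f \<in> onshell_ideal gr m"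
proof (induction f rule: poly_mapping_single_induct)
  case (single w c)
  let ?N = "lin_ext (\<lambda>w. Poly_Mapping.single w (1 / fact (length w))) :: 'a expr \<Rightarrow> 'a expr"
  have "?N (sym_word gr w) = lin_ext (\<lambda>y. scalar (1 / fact (length w)) * Poly_Mapping.single y 1) (sym_word gr w)"
    by (rule lin_ext_cong) (simp add: keys_sym_word mult_single)
  also have "\<dots> = scalar (1 / fact (length w)) * sym_word gr w"
    using poly_mapping_eq_sum_single[of "sym_word gr w"]
    by (simp add: lin_ext_scalar_family) (simp add: lin_ext_def mult_single)
  finally have N: "?N (sym_word gr w) = scalar (1 / fact (length w)) * sym_word gr w" .
  then have "?N (symmetrize gr (Poly_Mapping.single w c)) - Poly_Mapping.single w c
      = scalar (c / fact (length w)) * (sym_word gr w - of_nat (fact (length w)) * Poly_Mapping.single w 1)"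
  proof -
    have "(of_nat (fact (length w)) :: 'a expr) = scalar (fact (length w))"
      by (metis single_of_nat of_nat_fact)
    then have "scalar (c / fact (length w)) * (of_nat (fact (length w)) * Poly_Mapping.single w 1)
        = Poly_Mapping.single w c"
      by (simp add: mult_single del: of_nat_fact)
    moreover have "?N (symmetrize gr (Poly_Mapping.single w c))
        = scalar (c / fact (length w)) * sym_word gr w"
      by (simp add: symmetrize_def N)
        (simp add: mult_single flip: mult.assoc)
    ultimately show ?thesis
      by (simp only: right_diff_distrib)
  qed
  also have "\<dots> \<in> onshell_ideal gr m"
    by (intro two_sided_ideal_mult_left sym_word_onshell)
  finally show ?case .
next
  case (add f g)
  then show ?case
    using two_sided_ideal.add[OF add] by (simp add: add_diff_add)
qed

theorem theorem4p7:
  fixes gr :: "'f::finite \<Rightarrow> bool"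
    and m :: "'f \<Rightarrow> real"
    and S :: "'i \<Rightarrow> 4 \<Rightarrow> 'f expr"
  assumes "\<And>\<alpha>. 0 \<le> m \<alpha>"
    and "\<And>I \<mu>. \<exists>k\<ge>4. has_canonical_dim gr m (S I \<mu>) k"
    and "\<And>I \<mu>. at_least_trilinear gr m (S I \<mu>)"
    and "\<And>I. onshell_eq gr m (\<Sum>\<mu>\<in>UNIV. total_deriv \<mu> (S I \<mu>)) 0"
  shows "\<exists>T :: 'i \<Rightarrow> 4 \<Rightarrow> 4 \<Rightarrow> 'f expr.
           (\<forall>I \<mu> \<nu>. T I \<mu> \<nu> = - T I \<nu> \<mu>) \<and>
           (\<forall>I \<mu>. onshell_eq gr m (S I \<mu>) (\<Sum>\<nu>\<in>UNIV. total_deriv \<nu> (T I \<mu> \<nu>)))"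
proof -
  let ?K = "onshell_ideal gr m"
  let ?N = "lin_ext (\<lambda>w. Poly_Mapping.single w (1 / fact (length w))) :: 'f expr \<Rightarrow> 'f expr"
  have "\<exists>T. (\<forall>\<mu> \<nu>. T \<mu> \<nu> = - T \<nu> \<mu>) \<and>
      (\<forall>\<mu>. S I \<mu> - (\<Sum>\<nu>\<in>UNIV. total_deriv \<nu> (T \<mu> \<nu>)) \<in> ?K)" for I
  proof -
    have "\<forall>\<mu>. \<exists>g. S I \<mu> - g \<in> ?K \<and> (\<forall>w\<in>Poly_Mapping.keys g. 3 \<le> length w)"
      using assms(3) by (simp add: at_least_trilinear_def onshell_eq_def)
    from choice[OF this] obtain g
      where "\<forall>\<mu>. S I \<mu> - g \<mu> \<in> ?K \<and> (\<forall>w\<in>Poly_Mapping.keys (g \<mu>). 3 \<le> length w)" ..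
    then have g: "S I \<mu> - g \<mu> \<in> ?K"
      and len: "w \<in> Poly_Mapping.keys (g \<mu>) \<Longrightarrow> 3 \<le> length w" for \<mu> w
      by blast+
    have "(\<Sum>\<mu>\<in>UNIV. total_deriv \<mu> (S I \<mu>)) \<in> ?K"
      using assms(4)[of I] by (simp add: onshell_eq_def)
    \<comment> \<open>The on-shell ideal is stable under d_mu, so closedness passes to the
      representatives \<open>g\<close>.\<close>
    from two_sided_ideal_diff[OF this two_sided_ideal_sum[OF total_deriv_onshell[OF g]]]
    have "(\<Sum>\<mu>\<in>UNIV. total_deriv \<mu> (S I \<mu>)) - (\<Sum>\<mu>\<in>UNIV. total_deriv \<mu> (S I \<mu> - g \<mu>)) \<in> ?K" .
    then have "(\<Sum>\<mu>\<in>UNIV. total_deriv \<mu> (g \<mu>)) \<in> ?K"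
      by (simp add: sum_subtractf)
    \<comment> \<open>After symmetrization closedness holds modulo the free equations alone, as the
      dictionary with momenta demands.\<close>
    from symmetrize_onshell[OF this]
    have closed: "(\<Sum>\<mu>\<in>UNIV. total_deriv \<mu> (symmetrize gr (g \<mu>))) \<in> two_sided_ideal (free_equations m)"
      by (simp add: symmetrize_sum symmetrize_total_deriv)
    have len': "\<forall>w\<in>Poly_Mapping.keys (symmetrize gr (g \<mu>)). 3 \<le> length w" for \<mu>
    proof
      fix w assume "w \<in> Poly_Mapping.keys (symmetrize gr (g \<mu>))"
      then obtain y where "y \<in> Poly_Mapping.keys (g \<mu>)" "w \<in> Poly_Mapping.keys (sym_word gr y)"
        using keys_lin_ext[of "sym_word gr" "g \<mu>"] by (auto simp: symmetrize_def)
      then show "3 \<le> length w"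
        using keys_sym_word len by fastforce
    qed
    obtain T where T: "\<forall>\<mu> \<nu>. T \<mu> \<nu> = - T \<nu> \<mu>"
      and exact: "\<And>\<mu>. ?N (symmetrize gr (g \<mu>)) - (\<Sum>\<nu>\<in>UNIV. total_deriv \<nu> (T \<mu> \<nu>))
        \<in> two_sided_ideal (free_equations m)"
      using free_exact[where f = "\<lambda>\<mu>. symmetrize gr (g \<mu>)", OF len' closed] by blast
    have "S I \<mu> - (\<Sum>\<nu>\<in>UNIV. total_deriv \<nu> (T \<mu> \<nu>)) \<in> ?K" for \<mu>
    proof -
      \<comment> \<open>Telescoping through the representative and its normalized
        symmetrization.\<close>
      have "(S I \<mu> - g \<mu>) - (?N (symmetrize gr (g \<mu>)) - g \<mu>)
          + (?N (symmetrize gr (g \<mu>)) - (\<Sum>\<nu>\<in>UNIV. total_deriv \<nu> (T \<mu> \<nu>))) \<in> ?K"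
        using two_sided_ideal.add[OF two_sided_ideal_diff[OF g normalized_symmetrize_onshell]
            subsetD[OF free_ideal_subset_onshell exact]] .
      then show ?thesis
        by simp
    qed
    with T show ?thesis
      by blast
  qed
  then have "\<forall>I. \<exists>T. (\<forall>\<mu> \<nu>. T \<mu> \<nu> = - T \<nu> \<mu>) \<and>
      (\<forall>\<mu>. S I \<mu> - (\<Sum>\<nu>\<in>UNIV. total_deriv \<nu> (T \<mu> \<nu>)) \<in> ?K)"
    by blast
  from choice[OF this] obtain T where "\<forall>I. (\<forall>\<mu> \<nu>. T I \<mu> \<nu> = - T I \<nu> \<mu>) \<and>
      (\<forall>\<mu>. S I \<mu> - (\<Sum>\<nu>\<in>UNIV. total_deriv \<nu> (T I \<mu> \<nu>)) \<in> ?K)" ..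
  then show ?thesis
    unfolding onshell_eq_def by blast
qed

end
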